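(* Let $\delta(t):=\max\{4t-1,2t\}$ for real $t>0$. (A) Let $\lambda\in(0,1)$. Then: (A1) for all integers $n\ge1$, $$\big\|\mathcal{C}_{n}^{(\lambda)}\big\|_2^2<\mathcal{B}\big(1-\lambda,\tfrac12\big)\frac{2^{1-2\lambda}}{\Gamma(\lambda)^2}\frac{1}{n^{2-2\lambda}};$$ (A2) as $n\to\infty$, $$\big\|\mathcal{C}_{n}^{(\lambda+1)}\big\|_2^2=\frac{n^{4\lambda}}{4\lambda\,\Gamma(2\lambda+1)^2}+O\big(n^{\delta(\lambda)}\big);$$ (A3) as $n\to\infty$, $$\big\|\sqrt{1-x^2}\,\mathcal{C}_{n-1}^{(\lambda+1)}\big\|_2^2<\frac{\mathcal{B}\big(1-\lambda,\tfrac12\big)}{\Gamma(\lambda+1)^2}\frac{n^{2\lambda}}{2^{1+2\lambda}}+O\big(n^{\delta(\lambda)-1}\big),$$ that is, there are constants $K,N>0$ depending only on $\lambda$ such that for all integers $n\ge N$ the left-hand side is less than $\frac{\mathcal{B}(1-\lambda,1/2)}{\Gamma(\lambda+1)^2}\frac{n^{2\lambda}}{2^{1+2\lambda}}+K n^{\delta(\lambda)-1}$. (B) Let $\lambda>1$. Then, as $n\to\infty$: (B1) $$\big\|\mathcal{C}_{n-2}^{(\lambda+1)}\big\|_2^2=\frac{n^{4\lambda}}{4\lambda\,\Gamma(2\lambda+1)^2}+\frac{\lambda-1}{\Gamma(2\lambda+1)^2}\,n^{4\lambda-1}+O\big(n^{4\lambda-2}\big);$$ (B2) $$\big\|\sq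rt{1-x^2}\,\mathcal{C}_{n-1}^{(\lambda+1)}\big\|_2^2=\frac{2\lambda-1}{4(\lambda-1)\Gamma(2\lambda+1)^2}\,n^{4\lambda-2}+O\big(n^{\delta(\lambda-1)+2}\big).$$
   Context: For $\lambda\in(-\tfrac12,0)\cup(0,\infty)$ and $n\in\mathbb{N}_0=\{0,1,2,\dots\}$, the Gegenbauer polynomial $\mathcal{C}_n^{(\lambda)}$ of index $\lambda$ and degree $n$ is the coefficient of $\alpha^n$ in the power series expansion $(1-2x\alpha+\alpha^2)^{-\lambda}=\sum_{n=0}^\infty \mathcal{C}_n^{(\lambda)}(x)\alpha^n$. For continuous $f:[0,1]\to\mathbb{R}$, $\|f\|_2^2:=\int_0^1[f(x)]^2\,\mathrm{d}x$ (integral over $[0,1]$, unweighted); in particular $\|\sqrt{1-x^2}\,\mathcal{C}_{m}^{(\mu)}\|_2^2=\int_0^1(1-x^2)[\mathcal{C}_m^{(\mu)}(x)]^2\,\mathrm{d}x$. $\Gamma$ is the gamma function and $\mathcal{B}(x,y)=\Gamma(x)\Gamma(y)/\Gamma(x+y)$ is the beta function. The index $\lambda$ is fixed, $n$ runs through the integers, and the implied constants in $O(\cdot)$ may depend on $\lambda$. *)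

theory Defs
  imports
    "HOL-Analysis.Analysis"
    "HOL-Library.Landau_Symbols"
    "HOL-Complex_Analysis.Laurent_Convergence"
begin

(* The expansion at 0 is unique (lemma real_fps_expansion_unique), and it exists for all real
   lam and x (lemma gegenbauer_has_fps_expansion), so the definite description is meaningful. *)
definition gegenbauer :: "real \<Rightarrow> nat \<Rightarrow> real \<Rightarrow> real" where
  "gegenbauer lam n x =
     fps_nth (THE F. (\<lambda>\<alpha>::real. (1 - 2 * x * \<alpha> + \<alpha>\<^sup>2) powr (- lam)) has_fps_expansion F) n"

definition l2_norm_sq :: "(real \<Rightarrow> real) \<Rightarrow> real" where
  "l2_norm_sq f = integral {0..1} (\<lambda>x. (f x)\<^sup>2)"

definition delta :: "real \<Rightarrow> real" where
  "delta t = max (4 * t - 1) (2 * t)"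

lemma real_fps_expansion_unique:
  fixes f :: "real \<Rightarrow> real"
  assumes "f has_fps_expansion F" and "f has_fps_expansion G"
  shows "F = G"
proof (rule ccontr)
  assume "F \<noteq> G"
  define H where "H = F - G"
  have "(\<lambda>x. f x - f x) has_fps_expansion H"
    unfolding H_def by (intro has_fps_expansion_diff assms)
  hence exp0: "(\<lambda>x. 0) has_fps_expansion H" by simp
  have "H \<noteq> 0" using \<open>F \<noteq> G\<close> by (simp add: H_def)
  define m where "m = subdegree H"
  have Hm: "fps_nth H m \<noteq> 0" using \<open>H \<noteq> 0\<close> by (simp add: m_def)
  define A where "A = fps_shift m H"
  have HA: "H = A * fps_X ^ m"
    unfolding A_def m_def by (simp add: subdegree_decompose[symmetric])
  have pos: "fps_conv_radius A > 0"
    using exp0 by (simp add: A_def has_fps_expansion_def)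
  have "eventually (\<lambda>x. x \<in> eball 0 (fps_conv_radius A)) (nhds (0::real))"
    using pos by (intro eventually_nhds_in_open) (auto simp: zero_ereal_def)
  moreover have "eventually (\<lambda>x. eval_fps H x = 0) (nhds (0::real))"
    using exp0 by (simp add: has_fps_expansion_def)
  ultimately have "eventually (\<lambda>x. x \<noteq> 0 \<longrightarrow> eval_fps A x = 0) (nhds 0)"
  proof eventually_elim
    case (elim x)
    hence "eval_fps H x = eval_fps A x * x ^ m"
      unfolding HA by (subst eval_fps_mult) auto
    thus ?case using elim by auto
  qed
  hence "eventually (\<lambda>x. 0 = eval_fps A x) (at 0)"
    by (auto simp: eventually_at_filter elim: eventually_mono)
  hence "(eval_fps A \<longlongrightarrow> 0) (at 0)"
    by (rule Lim_transform_eventually[OF tendsto_const])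
  moreover have "isCont (eval_fps A) 0"
    using pos by (intro continuous_eval_fps) (auto simp: zero_ereal_def)
  hence "(eval_fps A \<longlongrightarrow> eval_fps A 0) (at 0)" by (simp add: isCont_def)
  ultimately have "eval_fps A 0 = 0" using tendsto_unique by (metis at_neq_bot)
  thus False using Hm by (simp add: eval_fps_at_0 A_def)
qed

lemma gegenbauer_genfun_has_fps_expansion:
  fixes lam x :: real
  shows "(\<lambda>\<alpha>. (1 - 2 * x * \<alpha> + \<alpha>\<^sup>2) powr (- lam)) has_fps_expansion
           (fps_binomial (- lam) oo (fps_X ^ 2 - fps_const (2 * x) * fps_X))"
    (is "?f has_fps_expansion ?R")
proof -
  define r where "r = (fps_X ^ 2 - fps_const (2 * x) * fps_X :: real fps)"
  define c where "c = (fps_X ^ 2 - fps_const (of_real (2 * x)) * fps_X :: complex fps)"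
  define C where "C = (fps_binomial (of_real (- lam)) oo c :: complex fps)"
  have rc: "fps_nth c n = of_real (fps_nth r n)" for n
    by (simp add: r_def c_def fps_X_power_nth)
  have pw: "fps_nth (c ^ i) n = of_real (fps_nth (r ^ i) n)" for i n
    by (induction i arbitrary: n) (auto simp: fps_mult_nth rc)
  have gb: "(of_real a gchoose k :: complex) = of_real (a gchoose k)" for a :: real and k
    by (simp add: gbinomial_prod_rev)
  have CR: "fps_nth C n = of_real (fps_nth ?R n)" for n
    using gb[of "- lam"] by (simp add: C_def r_def[symmetric] fps_compose_nth pw)
  have "((\<lambda>z::complex. (1 + z) powr of_real (- lam)) \<circ> (\<lambda>z. z ^ 2 - of_real (2 * x) * z))
          has_fps_expansion C"
    unfolding C_def c_def by (intro fps_expansion_intros) simp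
  hence C: "fps_conv_radius C > 0"
    "eventually (\<lambda>z. eval_fps C z = (1 + (z ^ 2 - of_real (2 * x) * z)) powr of_real (- lam)) (nhds 0)"
    by (auto simp: has_fps_expansion_def o_def)
  have rad: "fps_conv_radius C = fps_conv_radius ?R"
    unfolding fps_conv_radius_def conv_radius_def by (simp add: CR)
  have "((of_real :: real \<Rightarrow> complex) \<longlongrightarrow> 0) (nhds 0)"
    using tendsto_of_real[OF filterlim_ident, of "0::real"] by simp
  from eventually_compose_filterlim[OF C(2) this]
  have ev1: "eventually (\<lambda>a::real. eval_fps C (of_real a) =
      (1 + (of_real a ^ 2 - of_real (2 * x) * of_real a)) powr of_real (- lam)) (nhds 0)" .
  have "((\<lambda>a::real. 1 - 2 * x * a + a\<^sup>2) \<longlongrightarrow> 1 - 2 * x * 0 + 0\<^sup>2) (nhds 0)"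
    by (intro tendsto_intros filterlim_ident)
  hence "((\<lambda>a::real. 1 - 2 * x * a + a\<^sup>2) \<longlongrightarrow> 1) (nhds 0)" by simp
  hence ev2: "eventually (\<lambda>a::real. 1 - 2 * x * a + a\<^sup>2 > 0) (nhds 0)"
    by (rule order_tendstoD) simp
  have ev3: "eventually (\<lambda>a. a \<in> eball 0 (fps_conv_radius ?R)) (nhds (0::real))"
    using C(1) unfolding rad by (intro eventually_nhds_in_open) (auto simp: zero_ereal_def)
  from ev1 ev2 ev3 have "eventually (\<lambda>a. eval_fps ?R a = ?f a) (nhds 0)"
  proof eventually_elim
    case (elim a)
    have sm: "summable (\<lambda>n. fps_nth ?R n * a ^ n)"
      using elim(3) by (intro summable_fps) auto
    have "of_real (eval_fps ?R a) = eval_fps C (of_real a)"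
      unfolding eval_fps_def using sm by (simp add: CR suminf_of_real)
    also have "\<dots> = of_real (1 - 2 * x * a + a\<^sup>2) powr of_real (- lam)"
      using elim(1) by (simp add: algebra_simps)
    also have "\<dots> = of_real (?f a)"
      using elim(2) by (subst powr_of_real) auto
    finally show ?case by (simp only: of_real_eq_iff)
  qed
  thus ?thesis using C(1) by (auto simp: has_fps_expansion_def rad)
qed

lemma gegenbauer_has_fps_expansion:
  "(\<lambda>\<alpha>. (1 - 2 * x * \<alpha> + \<alpha>\<^sup>2) powr (- lam)) has_fps_expansion Abs_fps (\<lambda>n. gegenbauer lam n x)"
proof -
  have "(THE F. (\<lambda>\<alpha>. (1 - 2 * x * \<alpha> + \<alpha>\<^sup>2) powr (- lam)) has_fps_expansion F) =
          fps_binomial (- lam) oo (fps_X ^ 2 - fps_const (2 * x) * fps_X)"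
  proof (rule the_equality)
    fix F assume "(\<lambda>\<alpha>. (1 - 2 * x * \<alpha> + \<alpha>\<^sup>2) powr (- lam)) has_fps_expansion F"
    thus "F = fps_binomial (- lam) oo (fps_X ^ 2 - fps_const (2 * x) * fps_X)"
      by (rule real_fps_expansion_unique[OF _ gegenbauer_genfun_has_fps_expansion])
  qed (rule gegenbauer_genfun_has_fps_expansion)
  thus ?thesis
    using gegenbauer_genfun_has_fps_expansion[of x lam] by (simp add: gegenbauer_def fps_nth_inverse)
qed

end

theory Submission
  imports
    Defs
    "HOL-Real_Asymp.Real_Asymp"
begin

text \<open>
  Write \<open>y\<close> for the Gegenbauer polynomial of index \<open>\<lambda>\<close> and degree \<open>n\<close>, and \<open>N = n (n + 2 \<lambda>)\<close>.
  Since \<open>y'\<close> is \<open>2 \<lambda>\<close> times the polynomial of index \<open>\<lambda> + 1\<close> and degree \<open>n - 1\<close>, everything is about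
  the norms of \<open>y\<close> and \<open>y'\<close>. Integrating the derivatives of \<open>(1 - x\<^sup>2) y y' - (\<lambda> - 1/2) x y\<^sup>2\<close> and
  \<open>x ((1 - x\<^sup>2) y'\<^sup>2 + N y\<^sup>2)\<close>, simplified by the differential equation, expresses the weighted and
  the unweighted norm of \<open>y'\<close> exactly through the norm of \<open>y\<close> and \<open>y(1)\<^sup>2\<close>. The value \<open>y(1)\<close> is a
  quotient of Gamma functions with a known expansion, so only upper bounds for the norm of \<open>y\<close> are
  needed. For \<open>\<lambda> \<le> 1\<close> they follow from a monotone Sonin function, which bounds
  \<open>(1 - x\<^sup>2) powr \<lambda> * y\<^sup>2\<close> by an expression in \<open>y(0)\<close> and \<open>y'(0)\<close>; for \<open>\<lambda> > 1\<close> the crude bound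
  \<open>y\<^sup>2 \<le> y(1)\<^sup>2\<close> at index \<open>\<lambda> - 1\<close>, fed into the second identity, is enough.
\<close>

section \<open>The generating function\<close>

lemma fps_deriv_binomial: "fps_deriv (fps_binomial c) = fps_const c * fps_binomial (c - 1)"
  for c :: "'a :: field_char_0"
proof (rule fps_ext)
  fix n
  show "fps_deriv (fps_binomial c) $ n = (fps_const c * fps_binomial (c - 1)) $ n"
    using gbinomial_absorption[of n c] by simp
qed

context
  fixes lam x :: real
begin

private abbreviation "F l \<equiv> Abs_fps (\<lambda>n. gegenbauer l n x)"
private abbreviation "r \<equiv> fps_X ^ 2 - fps_const (2 * x) * fps_X"

private lemma F_eq: "F l = fps_binomial (- l) oo r"
  by (rule real_fps_expansion_unique[OF gegenbauer_has_fps_expansion gegenbauer_genfun_has_fps_expansion])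

text \<open>\<open>F l\<close> is the series of the power -l of \<open>1 + r\<close>, where
  \<open>1 + r\<close> stands for 1 - 2 x alpha + alpha^2. Splitting off one factor
  \<open>1 + r\<close> raises the index by one.\<close>

private lemma F_Suc: "F lam = F (lam + 1) * (1 + r)"
proof -
  have *: "fps_binomial (- lam) = fps_binomial (- (lam + 1)) * (1 + fps_X)"
    using fps_binomial_add_mult[of "- (lam + 1)" 1] by (simp add: fps_binomial_1)
  show ?thesis
    unfolding F_eq * by (subst fps_compose_mult_distrib) (simp_all add: fps_compose_add_distrib)
qed

text \<open>The chain rule in alpha; the inner derivative of \<open>r\<close> is 2 (alpha -
  x).\<close>

private lemma F_deriv: "fps_deriv (F lam) = F (lam + 1) * (fps_const (2 * lam) * (fps_const x - fps_X))"
proof -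
  have d: "fps_deriv r = 2 * fps_X - fps_const (2 * x)"
    unfolding fps_deriv_sub fps_deriv_power by simp
  have "fps_deriv (F lam) = ((fps_const (- lam) oo r) * F (lam + 1)) * fps_deriv r"
    unfolding F_eq
    by (subst fps_compose_deriv) (simp_all add: fps_deriv_binomial fps_compose_mult_distrib del: fps_deriv_power)
  also have "\<dots> = F (lam + 1) * (fps_const (- lam) * (2 * fps_X - fps_const (2 * x)))"
    unfolding d by simp
  also have "fps_const (- lam) * (2 * fps_X - fps_const (2 * x)) =
     fps_const (2 * lam) * (fps_const x - fps_X)"
    by (rule fps_ext) (simp add: fps_numeral_fps_const algebra_simps)
  finally show ?thesis .
qed

lemma gegenbauer_0 [simp]: "gegenbauer lam 0 x = 1"
  using arg_cong[OF F_eq[of lam], of "\<lambda>G. fps_nth G 0"] by simp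

text \<open>Compares the coefficients of alpha^(n+2) in \<open>F_Suc\<close>.\<close>

lemma gegenbauer_step_index:
  "gegenbauer lam (Suc (Suc n)) x =
     gegenbauer (lam + 1) (Suc (Suc n)) x - 2 * x * gegenbauer (lam + 1) (Suc n) x
     + gegenbauer (lam + 1) n x"
proof -
  have "F (lam + 1) * (1 + r) =
      F (lam + 1) + F (lam + 1) * fps_X ^ 2 - fps_const (2 * x) * (F (lam + 1) * fps_X)"
    by (simp add: algebra_simps)
  with F_Suc have "F lam = F (lam + 1) + F (lam + 1) * fps_X ^ 2
      - fps_const (2 * x) * (F (lam + 1) * fps_X)" by simp
  from arg_cong[OF this, of "\<lambda>G. fps_nth G (Suc (Suc n))"] show ?thesis
    by (simp add: fps_X_power_mult_right_nth)
qed

text \<open>Compares the coefficients of alpha^n in \<open>F_deriv\<close>.\<close>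

lemma gegenbauer_step_degree:
  "real (n + 1) * gegenbauer lam (Suc n) x =
     2 * lam * (x * gegenbauer (lam + 1) n x - (if n = 0 then 0 else gegenbauer (lam + 1) (n - 1) x))"
proof -
  have "fps_deriv (F lam) = fps_const (2 * lam) * (fps_const x * F (lam + 1) - F (lam + 1) * fps_X)"
    unfolding F_deriv by (simp add: algebra_simps)
  from arg_cong[OF this, of "\<lambda>G. fps_nth G n"] show ?thesis
    by simp
qed

end

section \<open>Derivatives, recurrences and special values\<close>

text \<open>The derivative in x, introduced through its closed form so that recurrences for it are
  available before differentiability is known. The separate case guards against truncated
  subtraction at degree 0.\<close>

definition gegenbauer' :: "real \<Rightarrow> nat \<Rightarrow> real \<Rightarrow> real" where
  "gegenbauer' lam n x = 2 * lam * (if n = 0 then 0 else gegenbauer (lam + 1) (n - 1) x)"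

lemma gegenbauer'_0 [simp]: "gegenbauer' lam 0 x = 0"
  and gegenbauer'_Suc: "gegenbauer' lam (Suc n) x = 2 * lam * gegenbauer (lam + 1) n x"
  by (simp_all add: gegenbauer'_def)

lemma gegenbauer_recurrence1:
  "real (Suc n) * gegenbauer lam (Suc n) x = x * gegenbauer' lam (Suc n) x - gegenbauer' lam n x"
  using gegenbauer_step_degree[of n lam x] by (cases n) (simp_all add: gegenbauer'_def algebra_simps)

text \<open>Strong induction on the degree, for all indices at once: the first recurrence expresses
  degree n of index \<open>lam\<close> through lower degrees of index \<open>lam + 1\<close>, and
  the same recurrence at index \<open>lam + 1\<close> simplifies the derivative of that expression.
  The inner function \<open>f\<close> makes it usable as a chain rule.\<close>

lemma has_field_derivative_gegenbauer [derivative_intros]: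
  assumes "(f has_field_derivative f') (at x within S)"
  shows "((\<lambda>x. gegenbauer lam n (f x)) has_field_derivative gegenbauer' lam n (f x) * f') (at x within S)"
proof -
  have "(gegenbauer lam n has_field_derivative gegenbauer' lam n x) (at x)" for x
  proof (induction n arbitrary: lam x rule: less_induct)
    case (less n)
    show ?case
    proof (cases n)
      case 0
      then show ?thesis by simp
    next
      case (Suc m)
      have eq: "gegenbauer lam n =
          (\<lambda>x. (x * (2 * lam * gegenbauer (lam + 1) m x) -
            (if m = 0 then 0 else 2 * lam * gegenbauer (lam + 1) (m - 1) x)) / real n)"
        using gegenbauer_recurrence1[of m lam] Suc
        by (auto simp: fun_eq_iff field_simps gegenbauer'_def)
      have d: "((\<lambda>x. if m = 0 then 0 else 2 * lam * gegenbauer (lam + 1) (m - 1) x)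
          has_field_derivative (if m = 0 then 0 else 2 * lam * gegenbauer' (lam + 1) (m - 1) x)) (at x)"
        using less.IH[of "m - 1" "lam + 1" x] Suc
        by (cases "m = 0") (auto intro!: derivative_eq_intros)
      \<comment> \<open>The first recurrence at index \<open>lam + 1\<close>, in a form that
        includes \<open>m = 0\<close>.\<close>
      have h: "x * gegenbauer' (lam + 1) m x - (if m = 0 then 0 else gegenbauer' (lam + 1) (m - 1) x) =
          m * gegenbauer (lam + 1) m x"
        using gegenbauer_recurrence1[of "m - 1" "lam + 1" x] by (cases m) auto
      have "2 * lam * gegenbauer (lam + 1) m x + x * (2 * lam * gegenbauer' (lam + 1) m x)
          - (if m = 0 then 0 else 2 * lam * gegenbauer' (lam + 1) (m - 1) x)
          = 2 * lam * gegenbauer (lam + 1) m x + 2 * lam * (m * gegenbauer (lam + 1) m x)"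
        unfolding h[symmetric] by (cases "m = 0") (auto simp: algebra_simps)
      also have "\<dots> = real n * gegenbauer' lam n x"
        using Suc by (simp add: gegenbauer'_Suc algebra_simps)
      finally have *: "(2 * lam * gegenbauer (lam + 1) m x + x * (2 * lam * gegenbauer' (lam + 1) m x)
          - (if m = 0 then 0 else 2 * lam * gegenbauer' (lam + 1) (m - 1) x)) / real n
          = gegenbauer' lam n x"
        using Suc by (simp add: divide_simps)
      have "(gegenbauer (lam + 1) m has_field_derivative gegenbauer' (lam + 1) m x) (at x)"
        using less.IH Suc by simp
      from DERIV_cdivide[where c = "real n",
          OF DERIV_diff[OF DERIV_mult[OF DERIV_ident DERIV_cmult[OF this, where c = "2 * lam"]] d]]
      show ?thesis
        by (subst eq, subst *[symmetric]) (simp add: mult_ac)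
    qed
  qed
  from DERIV_chain2[OF this assms] show ?thesis .
qed

definition gegenbauer'' :: "real \<Rightarrow> nat \<Rightarrow> real \<Rightarrow> real" where
  "gegenbauer'' lam n x = 2 * lam * (if n = 0 then 0 else gegenbauer' (lam + 1) (n - 1) x)"

lemma has_field_derivative_gegenbauer' [derivative_intros]:
  assumes "(f has_field_derivative f') (at x within S)"
  shows "((\<lambda>x. gegenbauer' lam n (f x)) has_field_derivative gegenbauer'' lam n (f x) * f') (at x within S)"
proof (cases n)
  case (Suc m)
  then show ?thesis
    using DERIV_cmult[OF has_field_derivative_gegenbauer[OF assms, of "lam + 1" m], of "2 * lam"]
    by (simp add: gegenbauer'_Suc gegenbauer''_def mult.assoc)
qed (simp add: gegenbauer''_def)

lemma continuous_on_gegenbauer [continuous_intros]: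
  "continuous_on S f \<Longrightarrow> continuous_on S (\<lambda>x. gegenbauer lam n (f x))"
proof -
  have "continuous_on UNIV (gegenbauer lam n)"
    using has_field_derivative_gegenbauer[OF DERIV_ident] by (rule DERIV_continuous_on)
  then show "continuous_on S f \<Longrightarrow> continuous_on S (\<lambda>x. gegenbauer lam n (f x))"
    by (rule continuous_on_compose2) auto
qed

lemma continuous_on_gegenbauer' [continuous_intros]:
  "continuous_on S f \<Longrightarrow> continuous_on S (\<lambda>x. gegenbauer' lam n (f x))"
  unfolding gegenbauer'_def by (cases "n = 0") (auto intro!: continuous_intros)

text \<open>Sum of the first recurrence and the index relation multiplied by \<open>2 * lam\<close>;
  the derivative of degree n - 1 cancels.\<close>

lemma gegenbauer_recurrence2:
  "(real n + 2 * lam) * gegenbauer lam n x = gegenbauer' lam (Suc n) x - x * gegenbauer' lam n x"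
proof (cases n)
  case 0
  then show ?thesis by (simp add: gegenbauer'_Suc)
next
  case (Suc m)
  have 1: "real n * gegenbauer lam n x = x * gegenbauer' lam n x - gegenbauer' lam m x"
    using gegenbauer_recurrence1[of m lam x] Suc by simp
  have 2: "2 * lam * gegenbauer lam n x =
      gegenbauer' lam (Suc n) x - 2 * x * gegenbauer' lam n x + gegenbauer' lam m x"
  proof (cases m)
    case 0
    have "gegenbauer l 1 x = 2 * l * x" for l
      using gegenbauer_recurrence1[of 0 l x] by (simp add: gegenbauer'_Suc)
    then show ?thesis using 0 Suc by (simp add: gegenbauer'_Suc algebra_simps)
  next
    case (Suc k)
    then show ?thesis using \<open>n = Suc m\<close>
      by (simp add: gegenbauer_step_index[of lam k x] gegenbauer'_Suc algebra_simps)
  qed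
  from 1 2 show ?thesis by (simp add: algebra_simps)
qed

text \<open>Eliminates the derivative of degree n from the first two recurrences.\<close>

lemma gegenbauer_recurrence3:
  "(1 - x\<^sup>2) * gegenbauer' lam (Suc n) x =
     (real n + 2 * lam) * gegenbauer lam n x - real (Suc n) * x * gegenbauer lam (Suc n) x"
proof -
  have "(1 - x\<^sup>2) * gegenbauer' lam (Suc n) x =
      (gegenbauer' lam (Suc n) x - x * gegenbauer' lam n x)
      - x * (x * gegenbauer' lam (Suc n) x - gegenbauer' lam n x)"
    by (simp add: algebra_simps power2_eq_square)
  then show ?thesis
    by (simp flip: gegenbauer_recurrence1 gegenbauer_recurrence2)
qed

text \<open>The third recurrence at index \<open>lam + 1\<close> and degree n - 1 computes (1 - x^2)
  y''; the first recurrence then replaces the derivative of degree n - 1.\<close>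

lemma gegenbauer_ODE:
  "(1 - x\<^sup>2) * gegenbauer'' lam n x =
     (2 * lam + 1) * x * gegenbauer' lam n x - real n * (real n + 2 * lam) * gegenbauer lam n x"
proof (cases n)
  case 0
  then show ?thesis by (simp add: gegenbauer''_def)
next
  case (Suc m)
  have 1: "real n * gegenbauer lam n x = x * gegenbauer' lam n x - gegenbauer' lam m x"
    using gegenbauer_recurrence1[of m lam x] Suc by simp
  have "(1 - x\<^sup>2) * gegenbauer'' lam n x =
      (real n + 2 * lam) * gegenbauer' lam m x - real m * x * gegenbauer' lam n x"
  proof (cases m)
    case 0
    then show ?thesis using Suc by (simp add: gegenbauer''_def)
  next
    case (Suc k)
    have "(1 - x\<^sup>2) * gegenbauer'' lam n x =
        2 * lam * ((1 - x\<^sup>2) * gegenbauer' (lam + 1) (Suc k) x)"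
      using \<open>n = Suc m\<close> Suc by (simp add: gegenbauer''_def)
    also have "\<dots> = (real n + 2 * lam) * (2 * lam * gegenbauer (lam + 1) k x)
        - real m * x * (2 * lam * gegenbauer (lam + 1) (Suc k) x)"
      unfolding gegenbauer_recurrence3 using \<open>n = Suc m\<close> Suc by (simp add: algebra_simps)
    finally show ?thesis using \<open>n = Suc m\<close> Suc by (simp add: gegenbauer'_Suc)
  qed
  also have "\<dots> = (2 * lam + 1) * x * gegenbauer' lam n x
      - (real n + 2 * lam) * (real n * gegenbauer lam n x)"
    unfolding 1 using Suc by (simp add: algebra_simps)
  finally show ?thesis by (simp add: algebra_simps)
qed

section \<open>Values at 1 and at 0\<close>

lemma gegenbauer_at_1: "gegenbauer lam n 1 = pochhammer (2 * lam) n / fact n"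
proof (induction n)
  case (Suc n)
  \<comment> \<open>At x = 1 the factor 1 - x^2 removes the derivative and leaves a two-term
    recursion.\<close>
  have "real (Suc n) * gegenbauer lam (Suc n) 1 = (real n + 2 * lam) * gegenbauer lam n 1"
    using gegenbauer_recurrence3[of 1 lam n] by simp
  then have "gegenbauer lam (Suc n) 1 = (real n + 2 * lam) * gegenbauer lam n 1 / real (Suc n)"
    by (simp add: field_simps)
  with Suc.IH show ?case
    by (simp add: pochhammer_Suc add.commute mult.commute)
qed simp

text \<open>At x = 0 the degree step lowers the degree by two and raises the index by one; hence
  here and in the even case the induction ranges over all indices.\<close>

lemma gegenbauer_at_0_odd: "gegenbauer lam (Suc (2 * m)) 0 = 0"
proof (induction m arbitrary: lam)
  case 0
  show ?case using gegenbauer_step_degree[of 0 lam 0] by simp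
next
  case (Suc m)
  show ?case using gegenbauer_step_degree[of "Suc (Suc (2 * m))" lam 0] Suc.IH[of "lam + 1"] by simp
qed

lemma gegenbauer_at_0_even: "gegenbauer lam (2 * m) 0 = (-1) ^ m * pochhammer lam m / fact m"
proof (induction m arbitrary: lam)
  case (Suc m)
  have "real (Suc m) * gegenbauer lam (2 * Suc m) 0 = - lam * gegenbauer (lam + 1) (2 * m) 0"
    using gegenbauer_step_degree[of "Suc (2 * m)" lam 0] by (simp add: algebra_simps)
  then have "gegenbauer lam (2 * Suc m) 0 = - lam * gegenbauer (lam + 1) (2 * m) 0 / real (Suc m)"
    by (simp add: field_simps)
  then show ?case unfolding Suc.IH[of "lam + 1"]
    by (simp add: pochhammer_rec mult_ac)
qed simp

lemma gegenbauer'_at_0_odd: 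
  "gegenbauer' lam (Suc (2 * m)) 0 = 2 * lam * ((-1) ^ m * pochhammer (lam + 1) m / fact m)"
  by (simp only: gegenbauer'_Suc gegenbauer_at_0_even)

lemma gegenbauer'_at_0_even: "gegenbauer' lam (2 * m) 0 = 0"
  by (cases m) (simp_all add: gegenbauer'_Suc gegenbauer_at_0_odd)

text \<open>By parity one of y(0) and y'(0) vanishes, which removes the boundary term at 0 in the
  first integral identity.\<close>

lemma gegenbauer_mult_gegenbauer'_at_0: "gegenbauer lam n 0 * gegenbauer' lam n 0 = 0"
  by (cases "even n") (auto elim!: evenE oddE simp: gegenbauer'_at_0_even gegenbauer_at_0_odd)

section \<open>Integral identities\<close>

lemma l2_norm_sq_weighted:
  "l2_norm_sq (\<lambda>x. sqrt (1 - x\<^sup>2) * f x) = integral {0..1} (\<lambda>x. (1 - x\<^sup>2) * (f x)\<^sup>2)"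
  unfolding l2_norm_sq_def
proof (rule integral_cong)
  fix x :: real assume "x \<in> {0..1}"
  then have "x\<^sup>2 \<le> 1" by (simp add: power_le_one)
  then show "(sqrt (1 - x\<^sup>2) * f x)\<^sup>2 = (1 - x\<^sup>2) * (f x)\<^sup>2"
    by (simp add: power_mult_distrib)
qed

lemma l2_norm_sq_scale: "l2_norm_sq (\<lambda>x. c * f x) = c\<^sup>2 * l2_norm_sq f"
  by (simp add: l2_norm_sq_def power_mult_distrib)

lemma l2_norm_sq_nonneg: "l2_norm_sq f \<ge> 0"
  unfolding l2_norm_sq_def
  by (cases "(\<lambda>x. (f x)\<^sup>2) integrable_on {0..1}")
     (auto intro: integral_nonneg simp: not_integrable_integral)

lemma integral_weighted_gegenbauer':
  "integral {0..1} (\<lambda>x. (1 - x\<^sup>2) * (gegenbauer' lam n x)\<^sup>2) =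
     (real n * (real n + 2 * lam) + (2 * lam - 1) / 2) * l2_norm_sq (gegenbauer lam n)
     - (2 * lam - 1) / 2 * (gegenbauer lam n 1)\<^sup>2"
proof -
  let ?y = "gegenbauer lam n" and ?d = "gegenbauer' lam n" and ?e = "gegenbauer'' lam n"
  define N where "N = real n * (real n + 2 * lam)"
  define c where "c = (2 * lam - 1) / 2"
  let ?P = "\<lambda>x. (1 - x\<^sup>2) * ?y x * ?d x - c * (x * (?y x)\<^sup>2)"
  let ?P' = "\<lambda>x. (1 - x\<^sup>2) * (?d x)\<^sup>2 - (N + c) * (?y x)\<^sup>2"
  have "(?P has_real_derivative ?P' x) (at x within {0..1})" for x
  proof -
    have "(?P has_real_derivative
        (- 2 * x * ?y x * ?d x + (1 - x\<^sup>2) * ?d x * ?d x + ?y x * ((1 - x\<^sup>2) * ?e x)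
        - c * ((?y x)\<^sup>2 + 2 * x * ?y x * ?d x))) (at x within {0..1})"
      by (auto intro!: derivative_eq_intros simp: algebra_simps)
    also have "- 2 * x * ?y x * ?d x + (1 - x\<^sup>2) * ?d x * ?d x + ?y x * ((1 - x\<^sup>2) * ?e x)
        - c * ((?y x)\<^sup>2 + 2 * x * ?y x * ?d x) = ?P' x"
      unfolding gegenbauer_ODE N_def by (simp add: c_def algebra_simps power2_eq_square diff_divide_distrib)
    finally show ?thesis .
  qed
  then have "(?P' has_integral (?P 1 - ?P 0)) {0..1}"
    by (intro fundamental_theorem_of_calculus) (auto simp: has_real_derivative_iff_has_vector_derivative)
  \<comment> \<open>At 1 the factor 1 - x^2 kills the term with y y'; at 0 that term vanishes by
    parity and the other through its factor x.\<close>
  then have "integral {0..1} ?P' = - c * (?y 1)\<^sup>2"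
    using gegenbauer_mult_gegenbauer'_at_0[of lam n] by (simp add: integral_unique)
  moreover have "integral {0..1} ?P' = integral {0..1} (\<lambda>x. (1 - x\<^sup>2) * (?d x)\<^sup>2)
      - (N + c) * l2_norm_sq ?y"
    unfolding l2_norm_sq_def
    by (subst integral_diff)
       (auto intro!: integrable_continuous_interval continuous_intros)
  ultimately show ?thesis by (simp add: N_def c_def)
qed

lemma l2_norm_sq_gegenbauer':
  "4 * lam * l2_norm_sq (gegenbauer' lam n) =
     (real n * (real n + 2 * lam) - (4 * lam - 1) * (2 * lam - 1) / 2) * (gegenbauer lam n 1)\<^sup>2
     + ((4 * lam - 2) * (real n * (real n + 2 * lam)) + (4 * lam - 1) * (2 * lam - 1) / 2)
       * l2_norm_sq (gegenbauer lam n)"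
proof -
  let ?y = "gegenbauer lam n" and ?d = "gegenbauer' lam n" and ?e = "gegenbauer'' lam n"
  define N where "N = real n * (real n + 2 * lam)"
  define W where "W = integral {0..1} (\<lambda>x. (1 - x\<^sup>2) * (?d x)\<^sup>2)"
  let ?P = "\<lambda>x. x * ((1 - x\<^sup>2) * (?d x)\<^sup>2 + N * (?y x)\<^sup>2)"
  \<comment> \<open>The bracket in \<open>?P\<close> has derivative 4 lam x y'^2. Its extra factor x
    gives x^2 y'^2, split as y'^2 - (1 - x^2) y'^2 to produce the two norms of y'.\<close>
  let ?P' = "\<lambda>x. (1 - 4 * lam) * ((1 - x\<^sup>2) * (?d x)\<^sup>2) + N * (?y x)\<^sup>2 + 4 * lam * (?d x)\<^sup>2"
  have "(?P has_real_derivative ?P' x) (at x within {0..1})" for x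
  proof -
    have "(?P has_real_derivative
        (((1 - x\<^sup>2) * (?d x)\<^sup>2 + N * (?y x)\<^sup>2) +
         x * (- 2 * x * (?d x)\<^sup>2 + 2 * ?d x * ((1 - x\<^sup>2) * ?e x) + 2 * N * ?y x * ?d x)))
        (at x within {0..1})"
      by (auto intro!: derivative_eq_intros simp: algebra_simps power2_eq_square)
    also have "((1 - x\<^sup>2) * (?d x)\<^sup>2 + N * (?y x)\<^sup>2) +
         x * (- 2 * x * (?d x)\<^sup>2 + 2 * ?d x * ((1 - x\<^sup>2) * ?e x) + 2 * N * ?y x * ?d x) = ?P' x"
      unfolding gegenbauer_ODE N_def by (simp add: field_simps power2_eq_square)
    finally show ?thesis .
  qed
  then have "(?P' has_integral (?P 1 - ?P 0)) {0..1}"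
    by (intro fundamental_theorem_of_calculus) (auto simp: has_real_derivative_iff_has_vector_derivative)
  then have "integral {0..1} ?P' = N * (?y 1)\<^sup>2"
    by (simp add: integral_unique)
  moreover have "integral {0..1} ?P' =
      (1 - 4 * lam) * W + N * l2_norm_sq ?y + 4 * lam * l2_norm_sq ?d"
    unfolding l2_norm_sq_def W_def
    by (subst integral_add integral_mult_right |
        (intro integrable_continuous_interval continuous_intros))+ (rule refl)
  \<comment> \<open>The first identity eliminates the weighted norm, so that only y(1) and the norm
    of y remain.\<close>
  moreover have "W = (N + (2 * lam - 1) / 2) * l2_norm_sq ?y - (2 * lam - 1) / 2 * (?y 1)\<^sup>2"
    unfolding W_def N_def by (rule integral_weighted_gegenbauer')
  ultimately have "4 * lam * l2_norm_sq ?d = N * (?y 1)\<^sup>2 - N * l2_norm_sq ?y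
      - (1 - 4 * lam) * ((N + (2 * lam - 1) / 2) * l2_norm_sq ?y - (2 * lam - 1) / 2 * (?y 1)\<^sup>2)"
    by (simp add: algebra_simps)
  also have "\<dots> = (N - (4 * lam - 1) * (2 * lam - 1) / 2) * (?y 1)\<^sup>2
     + ((4 * lam - 2) * N + (4 * lam - 1) * (2 * lam - 1) / 2) * l2_norm_sq ?y"
    by (simp add: field_simps)
  finally show ?thesis by (simp add: N_def)
qed

text \<open>The energy \<open>(1 - x\<^sup>2) y'\<^sup>2 + n (n + 2 \<lambda>) y\<^sup>2\<close> has derivative \<open>4 \<lambda> x y'\<^sup>2\<close>.\<close>
lemma gegenbauer_le_at_1:
  assumes "lam > 0" "0 \<le> x" "x \<le> 1"
  shows "(gegenbauer lam n x)\<^sup>2 \<le> (gegenbauer lam n 1)\<^sup>2"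
proof (cases "n = 0")
  case False
  let ?y = "gegenbauer lam n" and ?d = "gegenbauer' lam n" and ?e = "gegenbauer'' lam n"
  define N where "N = real n * (real n + 2 * lam)"
  have N: "N > 0" using False assms by (simp add: N_def add_pos_pos)
  let ?P = "\<lambda>x. (1 - x\<^sup>2) * (?d x)\<^sup>2 + N * (?y x)\<^sup>2"
  have "?P x \<le> ?P 1"
  proof (rule DERIV_nonneg_imp_nondecreasing[OF assms(3)])
    fix t assume "x \<le> t" "t \<le> 1"
    have "(?P has_real_derivative
        (- 2 * t * (?d t)\<^sup>2 + 2 * ?d t * ((1 - t\<^sup>2) * ?e t) + 2 * N * ?y t * ?d t)) (at t)"
      by (auto intro!: derivative_eq_intros simp: algebra_simps power2_eq_square)
    also have "- 2 * t * (?d t)\<^sup>2 + 2 * ?d t * ((1 - t\<^sup>2) * ?e t) + 2 * N * ?y t * ?d t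
        = 4 * lam * t * (?d t)\<^sup>2"
      unfolding gegenbauer_ODE N_def by (simp add: field_simps power2_eq_square)
    finally show "\<exists>d. (?P has_real_derivative d) (at t) \<and> d \<ge> 0"
      using assms \<open>x \<le> t\<close> by auto
  qed
  moreover have "(1 - x\<^sup>2) * (?d x)\<^sup>2 \<ge> 0"
    using assms by (auto intro!: mult_nonneg_nonneg simp: power_le_one)
  ultimately have "N * (?y x)\<^sup>2 \<le> N * (?y 1)\<^sup>2" by simp
  then show ?thesis
    using N by (rule mult_left_le_imp_le)
qed simp

section \<open>Sonin's bound for indices at most one\<close>

lemma powr_square: "(x powr a)\<^sup>2 = x powr (2 * a)" for x a :: real
  by (simp add: power2_eq_square flip: powr_add)

text \<open>With \<open>M\<close> the weighted arithmetic mean, ln z \<le> z - 1 is applied to a/M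
  and b/M. The weighted right-hand sides add up to 0, and the first inequality is strict because a
  differs from b and hence from \<open>M\<close>.\<close>

lemma weighted_AM_GM_strict:
  fixes a b t :: real
  assumes "a > 0" "b > 0" "a \<noteq> b" "0 < t" "t < 1"
  shows "a powr t * b powr (1 - t) < t * a + (1 - t) * b"
proof -
  define M where "M = t * a + (1 - t) * b"
  have M: "M > 0" using assms by (simp add: M_def add_pos_pos)
  have "a / M \<noteq> 1"
  proof
    assume "a / M = 1"
    then have "(1 - t) * (a - b) = 0" using M by (simp add: M_def algebra_simps)
    with assms show False by simp
  qed
  then have "ln (a / M) < a / M - 1"
    using ln_le_minus_one[of "a / M"] ln_eq_minus_one[of "a / M"] assms M by force
  then have "t * ln (a / M) < t * (a / M - 1)" using assms by simp
  moreover have "(1 - t) * ln (b / M) \<le> (1 - t) * (b / M - 1)"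
    using ln_le_minus_one[of "b / M"] assms M by (intro mult_left_mono) auto
  moreover have "t * (a / M - 1) + (1 - t) * (b / M - 1) = 0"
    using M by (simp add: field_simps) (simp add: M_def algebra_simps)
  ultimately have "t * ln a + (1 - t) * ln b < ln M"
    using assms M by (simp add: ln_div algebra_simps)
  then have "exp (t * ln a + (1 - t) * ln b) < M"
    using M by (metis exp_less_cancel_iff exp_ln)
  then show ?thesis
    using assms by (simp add: powr_def exp_add M_def)
qed

lemma Gamma_real_plus1: "x > 0 \<Longrightarrow> Gamma (x + 1) = x * Gamma x" for x :: real
  by (rule Gamma_plus1) (auto elim!: nonpos_Ints_cases)

text \<open>Log-convexity of Gamma between x and x + 1, where the functional equation turns ln
  Gamma(x + 1) into ln x + ln Gamma(x).\<close>

lemma Gamma_add_le_powr: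
  fixes x t :: real
  assumes "x > 0" "0 \<le> t" "t \<le> 1"
  shows "Gamma (x + t) \<le> x powr t * Gamma x"
proof -
  have pos: "Gamma x > 0" "Gamma (x + t) > 0"
    using assms by (auto intro: Gamma_real_pos)
  then have G: "Gamma x \<noteq> 0" "Gamma (x + t) \<noteq> 0" "Gamma (x + 1) = x * Gamma x"
    using assms Gamma_real_plus1[of x] by linarith+
  have "(ln \<circ> Gamma) ((1 - t) *\<^sub>R x + t *\<^sub>R (x + 1)) \<le>
      (1 - t) * (ln \<circ> Gamma) x + t * (ln \<circ> Gamma) (x + 1)"
    using assms by (intro convex_onD[OF log_convex_Gamma_real]) auto
  also have "(1 - t) *\<^sub>R x + t *\<^sub>R (x + 1) = x + t" by (simp add: algebra_simps)
  finally have "ln (Gamma (x + t)) \<le> t * ln x + ln (Gamma x)"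
    using G assms by (simp add: ln_mult algebra_simps)
  also have "\<dots> = ln (x powr t * Gamma x)"
    using G assms by (simp add: ln_mult ln_powr)
  finally show ?thesis
    using pos assms by (subst (asm) ln_le_cancel_iff) auto
qed

text \<open>The non-strict bound is used at x + 1. Both sides are brought back to x by the
  functional equation, and strictness comes from AM-GM: (x + 1)^t x^(1 - t) < x + t.\<close>

lemma Gamma_add_less_powr:
  fixes x t :: real
  assumes "x > 0" "0 < t" "t < 1"
  shows "Gamma (x + t) < x powr t * Gamma x"
proof -
  have "(x + t) * Gamma (x + t) = Gamma (x + 1 + t)"
    using assms Gamma_real_plus1[of "x + t"] by (simp add: add_ac)
  also have "\<dots> \<le> (x + 1) powr t * (x * Gamma x)"
    using Gamma_add_le_powr[of "x + 1" t] assms by (simp add: Gamma_real_plus1)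
  also have "\<dots> = (x powr t * x powr (1 - t)) * ((x + 1) powr t * Gamma x)"
    using assms by (simp flip: powr_add)
  also have "\<dots> = (x powr t * Gamma x) * ((x + 1) powr t * x powr (1 - t))"
    by (simp only: mult_ac)
  also have "\<dots> < (x powr t * Gamma x) * (t * (x + 1) + (1 - t) * x)"
    using assms by (intro mult_strict_left_mono weighted_AM_GM_strict) (auto intro!: Gamma_real_pos)
  also have "t * (x + 1) + (1 - t) * x = x + t" by (simp add: algebra_simps)
  finally show ?thesis using assms by (simp add: mult.commute)
qed

text \<open>Sonin's function for \<open>u \<theta> = (sin \<theta>) powr \<lambda> * y (cos \<theta>)\<close>, which satisfies
  \<open>u'' + ((n + \<lambda>)\<^sup>2 + \<lambda> (1 - \<lambda>) / (sin \<theta>)\<^sup>2) u = 0\<close>, written in the variable \<open>x = cos \<theta>\<close>.\<close>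
lemma gegenbauer_sonin_bound:
  assumes lam: "0 < lam" "lam \<le> 1" and n: "n \<ge> 1" and x: "0 \<le> x" "x < 1"
  shows "(1 - x\<^sup>2) powr lam * (gegenbauer lam n x)\<^sup>2 \<le>
     (gegenbauer lam n 0)\<^sup>2 + (gegenbauer' lam n 0)\<^sup>2 / (lam * (real n + 1)\<^sup>2 + (1 - lam) * (real n)\<^sup>2)"
proof -
  let ?y = "gegenbauer lam n" and ?d = "gegenbauer' lam n" and ?e = "gegenbauer'' lam n"
  define a where "a = (real n + lam)\<^sup>2"
  define b where "b = lam * (1 - lam)"
  have a: "a > 0" and b: "b \<ge> 0" using lam n by (auto simp: a_def b_def)
  \<comment> \<open>With x = cos \<theta> one has u'(\<theta>) = - (sin \<theta>)^(lam - 1) v, and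
    the coefficient of u in the equation is psi / (sin \<theta>)^2. So \<open>P\<close> below is u^2
    + u'^2 divided by that coefficient.\<close>
  define v where "v = (\<lambda>t. (1 - t\<^sup>2) * ?d t - lam * t * ?y t)"
  define psi where "psi = (\<lambda>t. a * (1 - t\<^sup>2) + b)"
  define P where "P = (\<lambda>t. (1 - t\<^sup>2) powr lam * ((?y t)\<^sup>2 + (v t)\<^sup>2 / psi t))"
  have psi: "psi t > 0" and w: "1 - t\<^sup>2 > 0" if "0 \<le> t" "t < 1" for t
  proof -
    show "1 - t\<^sup>2 > 0" using that by (simp add: power_less_one_iff abs_square_less_1)
    then show "psi t > 0" using a b by (auto simp: psi_def intro!: add_pos_nonneg)
  qed
  have "P x \<le> P 0"
  proof (rule DERIV_nonpos_imp_nonincreasing[OF x(1)])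
    fix t assume t: "0 \<le> t" "t \<le> x"
    then have t': "0 \<le> t" "t < 1" using x by auto
    note psi = psi[OF t'] and w = w[OF t']
    \<comment> \<open>The power with exponent \<open>lam - 1\<close> is factored out of the whole
      derivative; what remains is rational in t, y, v and psi.\<close>
    define p where "p = (1 - t\<^sup>2) powr (lam - 1)"
    have p: "p > 0" "(1 - t\<^sup>2) powr lam = (1 - t\<^sup>2) * p"
      using w powr_mult_base[of "1 - t\<^sup>2" "lam - 1"] by (simp_all add: p_def)
    define v' where "v' = (1 - t\<^sup>2) * ?e t - 2 * t * ?d t - lam * ?y t - lam * t * ?d t"
    have dv: "(v has_real_derivative v') (at t)"
      unfolding v_def v'_def by (auto intro!: derivative_eq_intros simp: algebra_simps)
    have dpsi: "(psi has_real_derivative - 2 * t * a) (at t)"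
      unfolding psi_def by (auto intro!: derivative_eq_intros)
    have dw: "((\<lambda>t. (1 - t\<^sup>2) powr lam) has_real_derivative - 2 * lam * t * p) (at t)"
      unfolding p_def using w by (auto intro!: derivative_eq_intros)
    have dq: "((\<lambda>t. (?y t)\<^sup>2 + (v t)\<^sup>2 / psi t) has_real_derivative
        2 * ?y t * ?d t + (2 * v t * v' * psi t - (v t)\<^sup>2 * (- 2 * t * a)) / (psi t)\<^sup>2) (at t)"
      using psi by (auto intro!: derivative_eq_intros dv dpsi simp: power2_eq_square)
    have "(P has_real_derivative
        (- 2 * lam * t * p) * ((?y t)\<^sup>2 + (v t)\<^sup>2 / psi t) +
        (1 - t\<^sup>2) powr lam * (2 * ?y t * ?d t +
          (2 * v t * v' * psi t - (v t)\<^sup>2 * (- 2 * t * a)) / (psi t)\<^sup>2)) (at t)"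
      using DERIV_mult[OF dw dq] unfolding P_def by (simp only: mult.commute)
    also have "(- 2 * lam * t * p) * ((?y t)\<^sup>2 + (v t)\<^sup>2 / psi t) +
        (1 - t\<^sup>2) powr lam * (2 * ?y t * ?d t +
          (2 * v t * v' * psi t - (v t)\<^sup>2 * (- 2 * t * a)) / (psi t)\<^sup>2) =
        p * (- 2 * lam * t * ((?y t)\<^sup>2 + (v t)\<^sup>2 / psi t) + 2 * ?y t * ((1 - t\<^sup>2) * ?d t) +
          (2 * v t * ((1 - t\<^sup>2) * v') * psi t + (v t)\<^sup>2 * (2 * t * (a * (1 - t\<^sup>2)))) / (psi t)\<^sup>2)"
      unfolding p(2) by (simp add: algebra_simps add_divide_distrib diff_divide_distrib)
    also have "(1 - t\<^sup>2) * ?d t = v t + lam * t * ?y t"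
      by (simp add: v_def)
    also have "(1 - t\<^sup>2) * v' = (lam - 1) * t * v t - ?y t * psi t"
      unfolding v'_def gegenbauer_ODE v_def psi_def a_def b_def
      by (simp add: algebra_simps power2_eq_square)
    also have "a * (1 - t\<^sup>2) = psi t - b" by (simp add: psi_def)
    \<comment> \<open>Everything cancels except the contribution of the monotone coefficient, whose
      sign is governed by b \<ge> 0, that is, by lam \<le> 1.\<close>
    also have "- 2 * lam * t * ((?y t)\<^sup>2 + (v t)\<^sup>2 / psi t) + 2 * ?y t * (v t + lam * t * ?y t) +
          (2 * v t * ((lam - 1) * t * v t - ?y t * psi t) * psi t + (v t)\<^sup>2 * (2 * t * (psi t - b)))
            / (psi t)\<^sup>2 = - (2 * t * b * (v t)\<^sup>2 / (psi t)\<^sup>2)"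
      using psi by (simp add: field_simps power2_eq_square)
    finally show "\<exists>d. (P has_real_derivative d) (at t) \<and> d \<le> 0"
      using p(1) b t by (auto intro!: exI mult_nonneg_nonneg divide_nonneg_nonneg)
  qed
  \<comment> \<open>(n + lam)^2 + lam (1 - lam), written as a convex combination of (n + 1)^2 and
    n^2 in preparation for AM-GM.\<close>
  moreover have "psi 0 = lam * (real n + 1)\<^sup>2 + (1 - lam) * (real n)\<^sup>2"
    by (simp add: psi_def a_def b_def power2_eq_square algebra_simps)
  moreover have "P 0 = (?y 0)\<^sup>2 + (?d 0)\<^sup>2 / psi 0"
    by (simp add: P_def v_def)
  moreover have "(1 - x\<^sup>2) powr lam * (?y x)\<^sup>2 \<le> P x"
    unfolding P_def using psi[OF x] by (intro mult_left_mono) auto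
  ultimately show ?thesis by simp
qed

section \<open>Sonin's constant at the origin\<close>

lemma pochhammer_over_fact:
  fixes x :: real
  assumes "x > 0"
  shows "pochhammer x m / fact m = Gamma (x + m) / (Gamma x * Gamma (m + 1))"
proof -
  have "x \<notin> \<int>\<^sub>\<le>\<^sub>0" using assms by (auto elim!: nonpos_Ints_cases)
  then have "pochhammer x m = Gamma (x + m) / Gamma x"
    by (simp add: pochhammer_Gamma)
  moreover have "Gamma (real m + 1) = fact m"
    using Gamma_fact[of m, where 'a = real] by (simp add: add.commute)
  ultimately show ?thesis by simp
qed

text \<open>Only one summand survives, depending on the parity of n. For even n strictness comes
  from the strict Gamma bound; for odd n the weak Gamma bound suffices, since AM-GM makes the
  denominator estimate strict.\<close>

lemma gegenbauer_at_0_bound: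
  assumes lam: "0 < lam" "lam < 1" and n: "n \<ge> 1"
  shows "(gegenbauer lam n 0)\<^sup>2 + (gegenbauer' lam n 0)\<^sup>2 / (lam * (real n + 1)\<^sup>2 + (1 - lam) * (real n)\<^sup>2)
     < ((real n / 2) powr (lam - 1) / Gamma lam)\<^sup>2"
proof (cases "even n")
  case True
  then obtain m where m: "n = 2 * m" by (auto elim: evenE)
  with n have m1: "m > 0" by auto
  have G: "Gamma lam > 0" using lam by (intro Gamma_real_pos)
  have "pochhammer lam m / fact m = Gamma (m + lam) / (Gamma lam * (m * Gamma m))"
    using lam m1 Gamma_real_plus1[of m] pochhammer_over_fact[of lam m] by (simp add: add.commute)
  also have "\<dots> < (m powr lam * Gamma m) / (Gamma lam * (m * Gamma m))"
    using Gamma_add_less_powr[of m lam] lam m1 G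
    by (intro divide_strict_right_mono) (auto intro!: mult_pos_pos Gamma_real_pos)
  also have "\<dots> = m powr (lam - 1) / Gamma lam"
    using m1 G Gamma_real_pos[of m] by (simp add: powr_diff less_imp_neq[symmetric])
  finally have "(pochhammer lam m / fact m)\<^sup>2 < (m powr (lam - 1) / Gamma lam)\<^sup>2"
    using lam by (intro power_strict_mono) (auto intro!: divide_nonneg_pos pochhammer_nonneg)
  moreover have "(gegenbauer lam n 0)\<^sup>2 = (pochhammer lam m / fact m)\<^sup>2"
    by (simp add: m gegenbauer_at_0_even power_mult_distrib power_divide flip: power_mult)
  ultimately show ?thesis
    using m by (simp add: gegenbauer'_at_0_even)
next
  case False
  then obtain m where m: "n = Suc (2 * m)" by (auto elim: oddE)
  define D where "D = lam * (real n + 1)\<^sup>2 + (1 - lam) * (real n)\<^sup>2"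
  have G: "Gamma lam > 0" using lam by (intro Gamma_real_pos)
  \<comment> \<open>The factor (n + 1)^(2 lam) is exactly what cancels the power of m + 1 = (n +
    1)/2 coming from y'(0)^2.\<close>
  have D: "((real n + 1)\<^sup>2) powr lam * ((real n)\<^sup>2) powr (1 - lam) < D"
    unfolding D_def using lam n by (intro weighted_AM_GM_strict) auto
  have D0: "D > 0" using D by (rule le_less_trans[rotated]) simp
  have "2 * lam * (pochhammer (lam + 1) m / fact m) = 2 * Gamma (real m + 1 + lam) / (Gamma lam * Gamma (real m + 1))"
    using lam Gamma_real_plus1[of lam] pochhammer_over_fact[of "lam + 1" m] by (simp add: add_ac)
  also have "\<dots> \<le> 2 * ((real m + 1) powr lam * Gamma (real m + 1)) / (Gamma lam * Gamma (real m + 1))"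
    using Gamma_add_le_powr[of "real m + 1" lam] lam G
    by (intro divide_right_mono) (auto intro!: mult_nonneg_nonneg Gamma_real_nonneg)
  also have "\<dots> = 2 * (real m + 1) powr lam / Gamma lam"
    using Gamma_real_pos[of "real m + 1"] by (simp add: less_imp_neq[symmetric])
  finally have "(2 * lam * (pochhammer (lam + 1) m / fact m))\<^sup>2 \<le> (2 * (real m + 1) powr lam / Gamma lam)\<^sup>2"
    using lam by (intro power_mono) (auto intro!: mult_nonneg_nonneg divide_nonneg_pos pochhammer_nonneg)
  moreover have "(gegenbauer' lam n 0)\<^sup>2 = (2 * lam * (pochhammer (lam + 1) m / fact m))\<^sup>2"
    by (simp add: m gegenbauer'_at_0_odd power_mult_distrib power_divide flip: power_mult)
  ultimately have "(gegenbauer' lam n 0)\<^sup>2 / D \<le> (2 * (real m + 1) powr lam / Gamma lam)\<^sup>2 / D"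
    using D0 by (simp add: divide_right_mono)
  also have "\<dots> < ((real n / 2) powr (lam - 1) / Gamma lam)\<^sup>2"
  proof -
    have half: "real m + 1 = (real n + 1) / 2" by (simp add: m field_simps)
    have "(2 * (real m + 1) powr lam)\<^sup>2 = 4 * ((real n + 1) / 2) powr (2 * lam)"
      unfolding half by (simp only: power_mult_distrib powr_square) simp
    also have "\<dots> = 4 / 2 powr (2 * lam) * ((real n + 1)\<^sup>2) powr lam"
      by (simp add: powr_divide powr_powr flip: powr_numeral)
    finally have 1: "(2 * (real m + 1) powr lam)\<^sup>2 = 4 / 2 powr (2 * lam) * ((real n + 1)\<^sup>2) powr lam" .
    have "((real n / 2) powr (lam - 1))\<^sup>2 = (real n / 2) powr (2 * lam - 2)"
      by (simp add: powr_square algebra_simps)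
    also have "\<dots> = 4 / 2 powr (2 * lam) * (real n powr (2 * lam - 2))"
      by (simp add: powr_divide powr_diff)
    also have "real n powr (2 * lam - 2) = inverse (((real n)\<^sup>2) powr (1 - lam))"
      using n by (simp add: powr_powr powr_minus[symmetric] algebra_simps flip: powr_numeral)
    finally have 2: "((real n / 2) powr (lam - 1))\<^sup>2 = 4 / 2 powr (2 * lam) * inverse (((real n)\<^sup>2) powr (1 - lam))" .
    have "((real n + 1)\<^sup>2) powr lam / D < inverse (((real n)\<^sup>2) powr (1 - lam))"
      using D D0 n by (simp add: field_simps)
    then have "4 / 2 powr (2 * lam) * (((real n + 1)\<^sup>2) powr lam / D)
        < 4 / 2 powr (2 * lam) * inverse (((real n)\<^sup>2) powr (1 - lam))"
      by (intro mult_strict_left_mono) auto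
    then have "(2 * (real m + 1) powr lam)\<^sup>2 / D < ((real n / 2) powr (lam - 1))\<^sup>2"
      unfolding 1 2 by simp
    then have "(2 * (real m + 1) powr lam)\<^sup>2 / D / (Gamma lam)\<^sup>2 < ((real n / 2) powr (lam - 1))\<^sup>2 / (Gamma lam)\<^sup>2"
      using G by (intro divide_strict_right_mono) auto
    then show ?thesis by (simp add: power_divide mult.commute)
  qed
  finally show ?thesis
    using m by (simp add: gegenbauer_at_0_odd D_def)
qed

lemma pochhammer_2: "pochhammer (2 :: real) m / fact m = real m + 1"
proof -
  have "Gamma (2 + real m) = (real m + 1) * Gamma (real m + 1)"
    using Gamma_real_plus1[of "real m + 1"] by (simp add: add_ac)
  moreover have "Gamma (2 :: real) = 1"
    using Gamma_real_plus1[of 1] by simp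
  moreover have "Gamma (real m + 1) \<noteq> 0"
    using Gamma_real_pos[of "real m + 1"] by linarith
  ultimately show ?thesis
    using pochhammer_over_fact[of 2 m] by simp
qed

text \<open>At index 1 (Chebyshev polynomials of the second kind) Sonin's constant is exactly
  1.\<close>

lemma gegenbauer_1_at_0:
  assumes "n \<ge> 1"
  shows "(gegenbauer 1 n 0)\<^sup>2 + (gegenbauer' 1 n 0)\<^sup>2 / (real n + 1)\<^sup>2 = 1"
proof (cases "even n")
  case True
  then obtain m where "n = 2 * m" by (auto elim: evenE)
  then show ?thesis
    by (simp add: gegenbauer_at_0_even gegenbauer'_at_0_even pochhammer_fact[symmetric] flip: power_mult)
next
  case False
  then obtain m where m: "n = Suc (2 * m)" by (auto elim: oddE)
  have "pochhammer (1 + 1 :: real) m / fact m = real m + 1"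
    using pochhammer_2[of m] by simp
  then have "gegenbauer' 1 n 0 = (-1) ^ m * (real n + 1)"
    using m gegenbauer'_at_0_odd[of 1 m] by (simp flip: times_divide_eq_right)
  then show ?thesis using m
    by (simp add: gegenbauer_at_0_odd power_mult_distrib flip: power_mult)
qed

section \<open>Norm bounds for indices at most one\<close>

text \<open>The substitution t = x^2 in the Beta integral with parameters 1/2 and 1 - lam. The open
  interval keeps it away from the endpoints, where the integrand may be singular.\<close>

lemma has_integral_one_minus_square_powr:
  fixes lam :: real
  assumes "lam < 1"
  shows "((\<lambda>x. (1 - x\<^sup>2) powr (- lam)) has_integral Beta (1 - lam) (1 / 2) / 2) {0<..<1}"
proof -
  define f where "f = (\<lambda>t::real. t powr (- 1 / 2) * (1 - t) powr (- lam))"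
  have "(f has_integral Beta (1 / 2) (1 - lam)) {0<..<1}"
    using has_integral_Beta_real[of "1 / 2" "1 - lam"] assms
    by (simp add: f_def has_integral_Icc_iff_Ioo)
  moreover have "f absolutely_integrable_on {0<..<1}"
    using calculation by (intro nonnegative_absolutely_integrable_1) (auto simp: f_def)
  moreover have "(\<lambda>x::real. x\<^sup>2) ` {0<..<1} = {0<..<1}"
  proof (intro equalityI subsetI)
    fix x :: real assume "x \<in> {0<..<1}"
    then have "x = (sqrt x)\<^sup>2" "sqrt x \<in> {0<..<1}" by auto
    then show "x \<in> (\<lambda>x. x\<^sup>2) ` {0<..<1}" by blast
  qed (auto simp: power_less_one_iff)
  ultimately have "f absolutely_integrable_on (\<lambda>x::real. x\<^sup>2) ` {0<..<1} \<and>
      integral ((\<lambda>x::real. x\<^sup>2) ` {0<..<1}) f = Beta (1 / 2) (1 - lam)"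
    by (simp add: integral_unique)
  then have "(\<lambda>x. \<bar>2 * x\<bar> * f (x\<^sup>2)) absolutely_integrable_on {0<..<1} \<and>
      integral {0<..<1} (\<lambda>x. \<bar>2 * x\<bar> * f (x\<^sup>2)) = Beta (1 / 2) (1 - lam)"
    by (subst has_absolute_integral_change_of_variables_1')
       (auto intro!: derivative_eq_intros inj_onI simp: power2_eq_iff)
  then have "((\<lambda>x. \<bar>2 * x\<bar> * f (x\<^sup>2)) has_integral Beta (1 / 2) (1 - lam)) {0<..<1}"
    using set_lebesgue_integral_eq_integral(1) by (auto simp: has_integral_integrable_integral)
  then have "((\<lambda>x. 2 * (1 - x\<^sup>2) powr (- lam)) has_integral Beta (1 / 2) (1 - lam)) {0<..<1}"
  proof (rule has_integral_eq[rotated])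
    fix x :: real assume x: "x \<in> {0<..<1}"
    then have "(x\<^sup>2) powr (- 1 / 2) = 1 / x"
      by (simp add: powr_powr powr_minus divide_simps flip: powr_numeral)
    then show "\<bar>2 * x\<bar> * f (x\<^sup>2) = 2 * (1 - x\<^sup>2) powr (- lam)"
      using x by (simp add: f_def)
  qed
  from has_integral_mult_right[OF this, of "1 / 2"] show ?thesis
    by (simp add: Beta_commute)
qed

text \<open>Integrates a pointwise majorant. At x = 1 that majorant is 0 by the convention for
  \<open>powr\<close>, so the bound is required only for x < 1 and the integrals are compared on the
  open interval.\<close>

lemma l2_norm_sq_le_Beta:
  fixes f :: "real \<Rightarrow> real"
  assumes "lam < 1" "continuous_on {0..1} f"
    and le: "\<And>x. 0 \<le> x \<Longrightarrow> x < 1 \<Longrightarrow> (f x)\<^sup>2 \<le> c * (1 - x\<^sup>2) powr (- lam)"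
  shows "l2_norm_sq f \<le> c * (Beta (1 - lam) (1 / 2) / 2)"
proof -
  have int: "((\<lambda>x. c * (1 - x\<^sup>2) powr (- lam)) has_integral c * (Beta (1 - lam) (1 / 2) / 2)) {0<..<1}"
    by (intro has_integral_mult_right has_integral_one_minus_square_powr assms)
  have "((\<lambda>x. (f x)\<^sup>2) has_integral l2_norm_sq f) {0<..<1}"
    unfolding l2_norm_sq_def has_integral_Icc_iff_Ioo[symmetric]
    by (intro integrable_integral integrable_continuous_interval continuous_intros assms)
  then show ?thesis
    by (rule has_integral_le[OF _ int]) (use le in auto)
qed

text \<open>Sonin's bound divided by (1 - x^2)^lam is integrable because lam < 1; the strict
  inequality is inherited from the estimate of Sonin's constant.\<close>

lemma l2_norm_sq_gegenbauer_less:
  assumes lam: "0 < lam" "lam < 1" and n: "n \<ge> 1"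
  shows "l2_norm_sq (gegenbauer lam n)
      < Beta (1 - lam) (1/2) * (2 powr (1 - 2 * lam) / (Gamma lam)\<^sup>2) * (1 / real n powr (2 - 2 * lam))"
proof -
  define K where "K = (gegenbauer lam n 0)\<^sup>2 +
    (gegenbauer' lam n 0)\<^sup>2 / (lam * (real n + 1)\<^sup>2 + (1 - lam) * (real n)\<^sup>2)"
  have B: "Beta (1 - lam) (1 / 2) > 0"
    using lam by (auto simp: Beta_def intro!: divide_pos_pos mult_pos_pos Gamma_real_pos)
  have "l2_norm_sq (gegenbauer lam n) \<le> K * (Beta (1 - lam) (1 / 2) / 2)"
  proof (rule l2_norm_sq_le_Beta[OF lam(2)])
    fix x :: real assume x: "0 \<le> x" "x < 1"
    then have "x\<^sup>2 < 1" by (simp add: power_less_one_iff abs_square_less_1)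
    then show "(gegenbauer lam n x)\<^sup>2 \<le> K * (1 - x\<^sup>2) powr (- lam)"
      using gegenbauer_sonin_bound[OF lam(1) less_imp_le[OF lam(2)] n x]
      by (simp add: K_def powr_minus field_simps)
  qed (intro continuous_intros)
  also have "\<dots> < ((real n / 2) powr (lam - 1) / Gamma lam)\<^sup>2 * (Beta (1 - lam) (1 / 2) / 2)"
    using gegenbauer_at_0_bound[OF assms] B unfolding K_def by (intro mult_strict_right_mono) auto
  \<comment> \<open>The leading factor 2 offsets the half in front of the Beta value.\<close>
  also have "((real n / 2) powr (lam - 1) / Gamma lam)\<^sup>2 =
      2 * (2 powr (1 - 2 * lam) / (Gamma lam)\<^sup>2) * (1 / real n powr (2 - 2 * lam))"
  proof -
    have "((real n / 2) powr (lam - 1))\<^sup>2 = (real n / 2) powr (2 * lam - 2)"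
      by (simp add: powr_square algebra_simps)
    also have "\<dots> = 2 * 2 powr (1 - 2 * lam) * (1 / real n powr (2 - 2 * lam))"
      using n by (simp add: powr_divide powr_diff)
    finally show ?thesis by (simp add: power_divide)
  qed
  finally show ?thesis by (simp add: mult_ac)
qed

text \<open>At index 1 Sonin's majorant 1/(1 - x^2) is not integrable. Its geometric mean with the
  uniform bound (n + 1)^2 is, at the cost of a factor n + 1.\<close>

lemma l2_norm_sq_gegenbauer_1_le:
  assumes n: "n \<ge> 1"
  shows "l2_norm_sq (gegenbauer 1 n) \<le> (real n + 1) * (Beta (1 - 1/2) (1/2) / 2)"
proof (rule l2_norm_sq_le_Beta)
  fix x :: real assume x: "0 \<le> x" "x < 1"
  then have w: "x\<^sup>2 < 1" by (simp add: power_less_one_iff abs_square_less_1)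
  have "(1 - x\<^sup>2) * (gegenbauer 1 n x)\<^sup>2 \<le> 1"
    using gegenbauer_sonin_bound[of 1 n x] gegenbauer_1_at_0[OF n] n x w by simp
  moreover have "(gegenbauer 1 n x)\<^sup>2 \<le> (real n + 1)\<^sup>2"
    using gegenbauer_le_at_1[of 1 x n] x pochhammer_2[of n] by (simp add: gegenbauer_at_1)
  ultimately have "(gegenbauer 1 n x)\<^sup>2 * ((1 - x\<^sup>2) * (gegenbauer 1 n x)\<^sup>2) \<le> (real n + 1)\<^sup>2 * 1"
    using w by (intro mult_mono) auto
  then have "((gegenbauer 1 n x)\<^sup>2)\<^sup>2 \<le> (real n + 1)\<^sup>2 * (1 / (1 - x\<^sup>2))"
    using w by (simp add: field_simps power2_eq_square)
  also have "\<dots> = ((real n + 1) * (1 - x\<^sup>2) powr (- (1 / 2)))\<^sup>2"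
    using w unfolding power_mult_distrib powr_square by (simp add: powr_minus_divide)
  finally show "(gegenbauer 1 n x)\<^sup>2 \<le> (real n + 1) * (1 - x\<^sup>2) powr (- (1 / 2))"
    by (rule power2_le_imp_le) simp
qed (auto intro!: continuous_intros)

section \<open>Asymptotics of Gamma quotients\<close>

text \<open>Summation of the increments out to infinity, where f vanishes; 1/n^3 is dominated by the
  telescoping differences of \<open>h\<close>.\<close>

lemma bigo_of_increments:
  fixes f :: "nat \<Rightarrow> real"
  assumes lim: "f \<longlonglongrightarrow> 0"
    and incr: "(\<lambda>n. f (Suc n) - f n) \<in> O(\<lambda>n. 1 / real n ^ 3)"
  shows "f \<in> O(\<lambda>n. 1 / real n ^ 2)"
proof -
  define h where "h = (\<lambda>n. 1 / real n ^ 2)"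
  have "(\<lambda>n. 1 / real n ^ 3) \<in> O(\<lambda>n. h n - h (Suc n))"
    unfolding h_def by real_asymp
  with incr have "(\<lambda>n. f (Suc n) - f n) \<in> O(\<lambda>n. h n - h (Suc n))"
    by (rule landau_o.big_trans)
  then obtain c where c: "c > 0" "eventually (\<lambda>n. norm (f (Suc n) - f n) \<le> c * norm (h n - h (Suc n))) at_top"
    by (elim landau_o.bigE)
  then obtain N where N: "\<And>n. n \<ge> N \<Longrightarrow> \<bar>f (Suc n) - f n\<bar> \<le> c * \<bar>h n - h (Suc n)\<bar>"
    by (auto simp: eventually_at_top_linorder)
  have "\<bar>f n\<bar> \<le> c * h n" if n: "n \<ge> max N 1" for n
  proof -
    have h: "h (Suc k) \<le> h k" if "k \<ge> n" for k
      using that n unfolding h_def by (intro divide_left_mono power_mono) auto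
    have step: "f (Suc k) - f k \<le> c * (h k - h (Suc k))" "f k - f (Suc k) \<le> c * (h k - h (Suc k))" 
      if "k \<ge> n" for k
      using N[of k] h[of k] that n by auto
    have h0: "h \<longlonglongrightarrow> 0"
      unfolding h_def by real_asymp
    have lims: "(\<lambda>k. f (k + n) - c * h (k + n)) \<longlonglongrightarrow> 0" "(\<lambda>k. - f (k + n) - c * h (k + n)) \<longlonglongrightarrow> 0"
      using tendsto_diff[OF LIMSEQ_ignore_initial_segment[OF lim, of n]
            tendsto_mult_left[OF LIMSEQ_ignore_initial_segment[OF h0, of n], of c]]
          tendsto_diff[OF tendsto_minus[OF LIMSEQ_ignore_initial_segment[OF lim, of n]]
            tendsto_mult_left[OF LIMSEQ_ignore_initial_segment[OF h0, of n], of c]]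
      by simp_all
    \<comment> \<open>Both sequences increase to 0, hence are nonpositive at every place; this
      bounds f and - f by c h.\<close>
    have "incseq (\<lambda>k. f (k + n) - c * h (k + n))" "incseq (\<lambda>k. - f (k + n) - c * h (k + n))"
      by (rule incseq_SucI, use step[of "_ + n"] in \<open>simp add: algebra_simps\<close>)+
    from incseq_le[OF this(1) lims(1), of 0] incseq_le[OF this(2) lims(2), of 0]
    show ?thesis by simp
  qed
  then show ?thesis
    unfolding h_def
    by (intro landau_o.bigI[OF c(1)] eventually_mono[OF eventually_ge_at_top[of "max N 1"]]) simp
qed

lemma exp_minus_one_minus_bound:
  assumes "\<bar>u\<bar> \<le> 1"
  shows "\<bar>exp u - 1 - u\<bar> \<le> (u::real)\<^sup>2"
proof (cases "u \<ge> 0")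
  case True
  then have "exp u \<le> 1 + u + u\<^sup>2" using exp_bound[of u] assms by simp
  then show ?thesis using exp_ge_add_one_self[of u] by linarith
next
  case False
  have pos: "1 + u + u\<^sup>2 \<ge> 0"
    using assms by (simp add: abs_le_iff)
  \<comment> \<open>For u < 0 the upper bound follows by comparing e^u (1 - u) \<le> 1 with (1 + u +
    u^2)(1 - u) = 1 - u^3 \<ge> 1.\<close>
  have "exp u * (1 - u) \<le> exp u * exp (- u)"
    using exp_ge_add_one_self[of "- u"] by (intro mult_left_mono) auto
  also have "\<dots> = 1" by (simp flip: exp_add)
  also have "1 \<le> 1 - u ^ 3" using False by (simp add: power_le_zero_eq)
  also have "1 - u ^ 3 = (1 + u + u\<^sup>2) * (1 - u)" by (simp add: power3_eq_cube power2_eq_square algebra_simps)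
  finally have "exp u \<le> 1 + u + u\<^sup>2" using False by (simp add: mult_le_cancel_right)
  then show ?thesis using exp_ge_add_one_self[of u] by linarith
qed

text \<open>The case of shift 1 rescaled by y = x / a.\<close>

lemma ln_shift_bigo:
  fixes a :: real
  assumes "a > 0"
  shows "(\<lambda>x. ln (x + a) - ln x - a / x + a\<^sup>2 / (2 * x\<^sup>2)) \<in> O(\<lambda>x. 1 / x ^ 3)"
proof -
  have "(\<lambda>y::real. ln (1 + 1 / y) - 1 / y + 1 / (2 * y\<^sup>2)) \<in> O(\<lambda>y. 1 / y ^ 3)"
    by real_asymp
  moreover have "filterlim (\<lambda>x. x / a) at_top at_top"
    using assms by real_asymp
  ultimately have "(\<lambda>x. ln (1 + 1 / (x / a)) - 1 / (x / a) + 1 / (2 * (x / a)\<^sup>2)) \<in> O(\<lambda>x. 1 / (x / a) ^ 3)"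
    by (rule landau_o.big.compose)
  also have "(\<lambda>x. 1 / (x / a) ^ 3) \<in> O(\<lambda>x. 1 / x ^ 3)"
    by (rule bigoI[of _ "a ^ 3"]) (use assms in \<open>simp add: power_divide\<close>)
  finally show ?thesis
  proof (rule landau_o.big.in_cong[THEN iffD1, rotated])
    show "eventually (\<lambda>x. ln (1 + 1 / (x / a)) - 1 / (x / a) + 1 / (2 * (x / a)\<^sup>2) =
        ln (x + a) - ln x - a / x + a\<^sup>2 / (2 * x\<^sup>2)) at_top"
      using eventually_gt_at_top[of 0]
    proof eventually_elim
      case (elim x)
      then have "1 + 1 / (x / a) = (x + a) / x" by (simp add: field_simps)
      then show ?case using elim assms by (simp add: ln_div power_divide)
    qed
  qed
qed

text \<open>The quotient \<open>R\<close> tends to 1 by the product limit for Gamma. After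
  subtraction of c/n its logarithm has increments O(1/n^3), computed from the functional equation,
  so it is O(1/n^2). Doubling and exponentiating yields the square.\<close>

lemma Gamma_quotient_bigo:
  fixes a :: real
  assumes a: "a > 0"
  shows "(\<lambda>n. (Gamma (real n + a) / (Gamma (real n) * real n powr a))\<^sup>2 - (1 + a * (a - 1) / real n))
           \<in> O(\<lambda>n. 1 / real n ^ 2)"
proof -
  define R where "R = (\<lambda>n. Gamma (real n + a) / (Gamma (real n) * real n powr a))"
  define c where "c = a * (a - 1) / 2"
  have c2: "a * (a - 1) = 2 * c" by (simp add: c_def)
  define f where "f = (\<lambda>n. ln (R n) - c / real n)"
  have R: "R n > 0" if "n > 0" for n
    using that a by (auto simp: R_def intro!: divide_pos_pos mult_pos_pos Gamma_real_pos)
  have "R \<longlonglongrightarrow> 1"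
  proof -
    have "a \<notin> \<int>\<^sub>\<le>\<^sub>0" using a by (auto elim!: nonpos_Ints_cases)
    then have G: "Gamma a \<noteq> 0" by (simp add: Gamma_eq_zero_iff)
    have "(\<lambda>n. Gamma a / Gamma_series' a n) \<longlonglongrightarrow> Gamma a / Gamma a"
      using G by (intro tendsto_intros Gamma_series'_LIMSEQ)
    moreover have "eventually (\<lambda>n. Gamma a / Gamma_series' a n = R n) sequentially"
      using eventually_gt_at_top[of 0]
    proof eventually_elim
      case (elim n)
      have "Gamma (real n) = fact (n - 1)"
        using Gamma_fact[of "n - 1", where 'a = real] elim by (simp add: of_nat_diff)
      moreover have "pochhammer a n = Gamma (a + n) / Gamma a"
        using \<open>a \<notin> \<int>\<^sub>\<le>\<^sub>0\<close> by (rule pochhammer_Gamma)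
      ultimately show ?case
        using elim G by (simp add: Gamma_series'_def R_def powr_def add.commute)
    qed
    ultimately show ?thesis using G by (simp add: tendsto_cong)
  qed
  then have "(\<lambda>n. ln (R n)) \<longlonglongrightarrow> ln 1" by (rule tendsto_ln) simp
  moreover have "(\<lambda>n. c / real n) \<longlonglongrightarrow> 0" by real_asymp
  ultimately have f0: "f \<longlonglongrightarrow> 0" unfolding f_def using tendsto_diff by fastforce
  have "f \<in> O(\<lambda>n. 1 / real n ^ 2)"
  proof (rule bigo_of_increments[OF f0])
    \<comment> \<open>\<open>L\<close> is the remainder of the second-order logarithm expansion,
      \<open>E\<close> that of the increment of c/x. In L(a) - a L(1) the terms in 1/x cancel, and
      those in 1/x^2 match c by its choice.\<close>
    define L where "L = (\<lambda>a x::real. ln (x + a) - ln x - a / x + a\<^sup>2 / (2 * x\<^sup>2))"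
    define E where "E = (\<lambda>x::real. c * (1 / x - 1 / (x + 1) - 1 / x\<^sup>2))"
    have "(\<lambda>x. L a x - a * L 1 x + E x) \<in> O(\<lambda>x. 1 / x ^ 3)"
    proof (intro sum_in_bigo)
      show "L a \<in> O(\<lambda>x. 1 / x ^ 3)" unfolding L_def using a by (rule ln_shift_bigo)
      have "L 1 \<in> O(\<lambda>x. 1 / x ^ 3)" unfolding L_def by (rule ln_shift_bigo) simp
      then show "(\<lambda>x. a * L 1 x) \<in> O(\<lambda>x. 1 / x ^ 3)" by simp
      have "(\<lambda>x::real. 1 / x - 1 / (x + 1) - 1 / x\<^sup>2) \<in> O(\<lambda>x. 1 / x ^ 3)" by real_asymp
      then show "E \<in> O(\<lambda>x. 1 / x ^ 3)" unfolding E_def by simp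
    qed
    then have "(\<lambda>n. L a (real n) - a * L 1 (real n) + E (real n)) \<in> O(\<lambda>n. 1 / real n ^ 3)"
      by (rule landau_o.big.compose) (rule filterlim_real_sequentially)
    moreover have "eventually (\<lambda>n. L a (real n) - a * L 1 (real n) + E (real n) = f (Suc n) - f n) sequentially"
      using eventually_gt_at_top[of 0]
    proof eventually_elim
      case (elim n)
      have *: "ln (R k) = ln (Gamma (real k + a)) - ln (Gamma (real k)) - a * ln (real k)" if "k > 0" for k
        using that a Gamma_real_pos[of "real k"] Gamma_real_pos[of "real k + a"]
        by (simp add: R_def ln_div ln_mult ln_powr less_imp_neq[symmetric])
      have "Gamma (real (Suc n) + a) = (real n + a) * Gamma (real n + a)"
        using Gamma_real_plus1[of "real n + a"] a elim by (simp add: add_ac)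
      then have "ln (Gamma (real (Suc n) + a)) = ln (real n + a) + ln (Gamma (real n + a))"
        using elim a Gamma_real_pos[of "real n + a"] by (simp add: ln_mult less_imp_neq[symmetric])
      moreover have "Gamma (real (Suc n)) = real n * Gamma (real n)"
        using Gamma_real_plus1[of "real n"] elim by (simp add: add_ac)
      then have "ln (Gamma (real (Suc n))) = ln (real n) + ln (Gamma (real n))"
        using elim Gamma_real_pos[of "real n"] by (simp add: ln_mult less_imp_neq[symmetric])
      ultimately have "ln (R (Suc n)) - ln (R n) = ln (real n + a) - ln (real n) - a * (ln (real n + 1) - ln (real n))"
        using elim *[of n] *[of "Suc n"] by (simp add: algebra_simps)
      moreover have "- a / real n + a\<^sup>2 / (2 * (real n)\<^sup>2) - a * (- 1 / real n + 1 / (2 * (real n)\<^sup>2)) =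
          c * (1 / (real n)\<^sup>2)"
        using elim by (simp add: c_def field_simps power2_eq_square)
      ultimately show ?case
        by (simp add: f_def L_def E_def algebra_simps)
    qed
    ultimately show "(\<lambda>n. f (Suc n) - f n) \<in> O(\<lambda>n. 1 / real n ^ 3)"
      by (simp cong: landau_o.big.in_cong)
  qed
  moreover define u where "u = (\<lambda>n. 2 * ln (R n))"
  ultimately have u1: "(\<lambda>n. u n - a * (a - 1) / real n) \<in> O(\<lambda>n. 1 / real n ^ 2)"
  proof -
    assume "f \<in> O(\<lambda>n. 1 / real n ^ 2)"
    then have "(\<lambda>n. 2 * f n) \<in> O(\<lambda>n. 1 / real n ^ 2)" by simp
    moreover have "(\<lambda>n. 2 * f n) = (\<lambda>n. u n - a * (a - 1) / real n)"
      unfolding c2 by (simp add: f_def u_def right_diff_distrib)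
    ultimately show ?thesis by simp
  qed
  have u2: "u \<in> O(\<lambda>n. 1 / real n)"
  proof -
    have "(\<lambda>n. 1 / real n ^ 2) \<in> O(\<lambda>n. 1 / real n)" by real_asymp
    with u1 have "(\<lambda>n. u n - a * (a - 1) / real n) \<in> O(\<lambda>n. 1 / real n)"
      by (rule landau_o.big_trans)
    moreover have "(\<lambda>n. a * (a - 1) / real n) \<in> O(\<lambda>n. 1 / real n)"
      by real_asymp
    ultimately have "(\<lambda>n. (u n - a * (a - 1) / real n) + a * (a - 1) / real n) \<in> O(\<lambda>n. 1 / real n)"
      by (rule sum_in_bigo(1))
    then show ?thesis by simp
  qed
  \<comment> \<open>As u = ln (R^2) is O(1/n), linearizing exp costs only O(1/n^2).\<close>
  have "(\<lambda>n. exp (u n) - 1 - u n) \<in> O(\<lambda>n. (u n)\<^sup>2)"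
  proof (rule bigoI[of _ 1])
    have "u \<longlonglongrightarrow> 2 * ln 1" unfolding u_def by (intro tendsto_intros \<open>(\<lambda>n. ln (R n)) \<longlonglongrightarrow> ln 1\<close>)
    then have "eventually (\<lambda>n. dist (u n) 0 < 1) sequentially" using tendstoD[of u 0 _ 1] by simp
    then show "eventually (\<lambda>n. norm (exp (u n) - 1 - u n) \<le> 1 * norm ((u n)\<^sup>2)) sequentially"
      by eventually_elim (simp add: exp_minus_one_minus_bound)
  qed
  also have "(\<lambda>n. (u n)\<^sup>2) \<in> O(\<lambda>n. (1 / real n)\<^sup>2)"
    using u2 by (rule landau_o.big_power)
  finally have "(\<lambda>n. exp (u n) - 1 - u n) \<in> O(\<lambda>n. 1 / real n ^ 2)"
    by (simp add: power_divide)
  from sum_in_bigo(1)[OF this u1] have "(\<lambda>n. exp (u n) - (1 + a * (a - 1) / real n)) \<in> O(\<lambda>n. 1 / real n ^ 2)"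
    by (simp add: algebra_simps)
  moreover have "eventually (\<lambda>n. exp (u n) - (1 + a * (a - 1) / real n) = (R n)\<^sup>2 - (1 + a * (a - 1) / real n)) sequentially"
    using eventually_gt_at_top[of 0]
  proof eventually_elim
    case (elim n)
    then show ?case using R[of n] by (simp add: u_def exp_double)
  qed
  ultimately have "(\<lambda>n. (R n)\<^sup>2 - (1 + a * (a - 1) / real n)) \<in> O(\<lambda>n. 1 / real n ^ 2)"
    by (simp cong: landau_o.big.in_cong)
  then show ?thesis by (simp only: R_def)
qed

section \<open>Norms of the polynomials\<close>

lemma bigo_powr_mono:
  fixes p q :: real
  assumes "p \<le> q" "f \<in> O(\<lambda>n. real n powr p)"
  shows "f \<in> O(\<lambda>n. real n powr q)"
proof -
  have "(\<lambda>n. real n powr p) \<in> O(\<lambda>n. real n powr q)"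
    by (intro bigoI[of _ 1] eventually_mono[OF eventually_ge_at_top[of 1]]) (use assms in \<open>auto intro: powr_mono\<close>)
  with assms(2) show ?thesis by (rule landau_o.big_trans)
qed

lemma bigo_divide_const: "f \<in> O(g) \<Longrightarrow> (\<lambda>n. f n / c) \<in> O(g)" for c :: real
  by (cases "c = 0") auto

lemma bigo_square_mult_powr:
  fixes q :: real
  assumes "f \<in> O(\<lambda>n. real n powr 2)" "g \<in> O(\<lambda>n. real n powr q)" "r = q + 2"
  shows "(\<lambda>n. f n * g n) \<in> O(\<lambda>n. real n powr r)"
  using landau_o.big_mult[OF assms(1,2)] assms(3) by (simp add: powr_add mult.commute)

text \<open>y(1) equals n^(2 lam - 1) / Gamma(2 lam) times the Gamma quotient with a = 2
  lam.\<close>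

lemma gegenbauer_at_1_bigo:
  assumes lam: "lam > 0"
  shows "(\<lambda>n. (gegenbauer lam n 1)\<^sup>2 -
           real n powr (4 * lam - 2) * (1 + 2 * lam * (2 * lam - 1) / real n) / (Gamma (2 * lam))\<^sup>2)
         \<in> O(\<lambda>n. real n powr (4 * lam - 4))"
proof -
  define R where "R = (\<lambda>n. Gamma (real n + 2 * lam) / (Gamma (real n) * real n powr (2 * lam)))"
  have "(\<lambda>n. real n powr (4 * lam - 2) / (Gamma (2 * lam))\<^sup>2 *
      ((R n)\<^sup>2 - (1 + 2 * lam * (2 * lam - 1) / real n))) \<in>
      O(\<lambda>n. real n powr (4 * lam - 2) * (1 / real n ^ 2))"
    unfolding R_def using lam by (intro landau_o.big.mult Gamma_quotient_bigo bigo_divide_const) auto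
  also have "(\<lambda>n. real n powr (4 * lam - 2) * (1 / real n ^ 2)) \<in> O(\<lambda>n. real n powr (4 * lam - 4))"
    by real_asymp
  finally show ?thesis
  proof (rule landau_o.big.in_cong[THEN iffD1, rotated])
    show "eventually (\<lambda>n. real n powr (4 * lam - 2) / (Gamma (2 * lam))\<^sup>2 *
      ((R n)\<^sup>2 - (1 + 2 * lam * (2 * lam - 1) / real n)) = (gegenbauer lam n 1)\<^sup>2 -
           real n powr (4 * lam - 2) * (1 + 2 * lam * (2 * lam - 1) / real n) / (Gamma (2 * lam))\<^sup>2) sequentially"
      using eventually_gt_at_top[of 0]
    proof eventually_elim
      case (elim n)
      have "gegenbauer lam n 1 = Gamma (2 * lam + n) / (Gamma (2 * lam) * (real n * Gamma (real n)))"
        using lam elim pochhammer_over_fact[of "2 * lam" n] Gamma_real_plus1[of "real n"]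
        by (simp add: gegenbauer_at_1)
      also have "\<dots> = R n * real n powr (2 * lam - 1) / Gamma (2 * lam)"
        using elim Gamma_real_pos[of "real n"] by (simp add: R_def powr_diff add.commute)
      finally have "(gegenbauer lam n 1)\<^sup>2 = real n powr (4 * lam - 2) / (Gamma (2 * lam))\<^sup>2 * (R n)\<^sup>2"
        by (simp add: power_divide power_mult_distrib powr_square algebra_simps)
      then show ?case by (simp add: algebra_simps)
    qed
  qed
qed

lemma gegenbauer_at_1_bigo_crude:
  assumes "lam > 0"
  shows "(\<lambda>n. (gegenbauer lam n 1)\<^sup>2) \<in> O(\<lambda>n. real n powr (4 * lam - 2))"
proof -
  define g where "g = (\<lambda>n. real n powr (4 * lam - 2) * (1 + 2 * lam * (2 * lam - 1) / real n) / (Gamma (2 * lam))\<^sup>2)"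
  have "(\<lambda>n. 1 + 2 * lam * (2 * lam - 1) / real n) \<in> O(\<lambda>n. 1)"
    by real_asymp
  then have "(\<lambda>n. real n powr (4 * lam - 2) / (Gamma (2 * lam))\<^sup>2 * (1 + 2 * lam * (2 * lam - 1) / real n))
      \<in> O(\<lambda>n. real n powr (4 * lam - 2) * 1)"
    by (intro landau_o.big.mult bigo_divide_const) auto
  then have "g \<in> O(\<lambda>n. real n powr (4 * lam - 2))" by (simp add: g_def)
  moreover have "(\<lambda>n. (gegenbauer lam n 1)\<^sup>2 - g n) \<in> O(\<lambda>n. real n powr (4 * lam - 2))"
    unfolding g_def by (rule bigo_powr_mono[OF _ gegenbauer_at_1_bigo[OF assms]]) simp
  ultimately have "(\<lambda>n. ((gegenbauer lam n 1)\<^sup>2 - g n) + g n) \<in> O(\<lambda>n. real n powr (4 * lam - 2))"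
    using sum_in_bigo(1) by fast
  then show ?thesis by simp
qed

text \<open>Inserts the expansion of y(1)^2 into the exact identity for the norm of y'. The norm of
  y enters with a factor of order n^2, so a bound with exponent e contributes exponent e + 2 to the
  error.\<close>

lemma l2_norm_sq_gegenbauer'_bigo:
  assumes lam: "lam > 0"
    and S: "(\<lambda>n. l2_norm_sq (gegenbauer lam n)) \<in> O(\<lambda>n. real n powr e)"
  shows "(\<lambda>n. 4 * lam * l2_norm_sq (gegenbauer' lam n) -
           (real n powr (4 * lam) + 4 * lam\<^sup>2 * real n powr (4 * lam - 1)) / (Gamma (2 * lam))\<^sup>2)
         \<in> O(\<lambda>n. real n powr max (4 * lam - 2) (e + 2))"
proof -
  define c where "c = (4 * lam - 1) * (2 * lam - 1) / 2"
  define b where "b = 2 * lam * (2 * lam - 1)"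
  define G where "G = (Gamma (2 * lam))\<^sup>2"
  define N where "N = (\<lambda>n. real n * (real n + 2 * lam))"
  define V where "V = (\<lambda>n. (gegenbauer lam n 1)\<^sup>2)"
  define V0 where "V0 = (\<lambda>n. real n powr (4 * lam - 2) * (1 + b / real n) / G)"
  have "(\<lambda>n. N n - c) \<in> O(\<lambda>n. real n powr 2)" "(\<lambda>n. (4 * lam - 2) * N n + c) \<in> O(\<lambda>n. real n powr 2)"
  proof -
    have "N \<in> O(\<lambda>n. real n powr 2)" "(\<lambda>n. c) \<in> O(\<lambda>n. real n powr 2)"
      unfolding N_def using lam by real_asymp+
    then show "(\<lambda>n. N n - c) \<in> O(\<lambda>n. real n powr 2)"
      "(\<lambda>n. (4 * lam - 2) * N n + c) \<in> O(\<lambda>n. real n powr 2)"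
      by (auto intro!: sum_in_bigo)
  qed
  then have 1: "(\<lambda>n. (N n - c) * (V n - V0 n)) \<in> O(\<lambda>n. real n powr (4 * lam - 2))"
    and 2: "(\<lambda>n. ((4 * lam - 2) * N n + c) * l2_norm_sq (gegenbauer lam n)) \<in> O(\<lambda>n. real n powr (e + 2))"
    unfolding V_def V0_def b_def G_def
    using gegenbauer_at_1_bigo[OF lam] S by (auto intro!: bigo_square_mult_powr)
  have 3: "(\<lambda>n. real n powr (4 * lam - 2) / G * (2 * lam * b - c - c * b / real n))
      \<in> O(\<lambda>n. real n powr (4 * lam - 2) * 1)"
  proof (intro landau_o.big.mult bigo_divide_const)
    have "(\<lambda>n. (2 * lam * b - c) - c * b / real n) \<in> O(\<lambda>n. 1)" by real_asymp
    then show "(\<lambda>n. 2 * lam * b - c - c * b / real n) \<in> O(\<lambda>n. 1)" .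
  qed auto
  have "(\<lambda>n. (N n - c) * (V n - V0 n) +
      real n powr (4 * lam - 2) / G * (2 * lam * b - c - c * b / real n) +
      ((4 * lam - 2) * N n + c) * l2_norm_sq (gegenbauer lam n))
      \<in> O(\<lambda>n. real n powr max (4 * lam - 2) (e + 2))"
    using 1 2 3 by (intro sum_in_bigo) (auto intro: bigo_powr_mono[rotated])
  then show ?thesis
  proof (rule landau_o.big.in_cong[THEN iffD1, rotated])
    show "eventually (\<lambda>n. (N n - c) * (V n - V0 n) +
      real n powr (4 * lam - 2) / G * (2 * lam * b - c - c * b / real n) +
      ((4 * lam - 2) * N n + c) * l2_norm_sq (gegenbauer lam n) =
      4 * lam * l2_norm_sq (gegenbauer' lam n) -
        (real n powr (4 * lam) + 4 * lam\<^sup>2 * real n powr (4 * lam - 1)) / (Gamma (2 * lam))\<^sup>2) sequentially"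
      using eventually_gt_at_top[of 0]
    proof eventually_elim
      case (elim n)
      define p where "p = real n powr (4 * lam - 2)"
      have p: "real n powr (4 * lam) = p * (real n)\<^sup>2" "real n powr (4 * lam - 1) = p * real n"
        using elim by (simp_all add: p_def powr_diff power2_eq_square)
      \<comment> \<open>The coefficient of the second-order term is 2 lam + b = 4 lam^2; all further
        terms of the product are bounded multiples of p.\<close>
      have key: "(N n - c) * V0 n = (p * (real n)\<^sup>2 + 4 * lam\<^sup>2 * (p * real n)) / G +
          p / G * (2 * lam * b - c - c * b / real n)"
      proof -
        have "(N n - c) * (1 + b / real n) = (real n)\<^sup>2 + (2 * lam + b) * real n + (2 * lam * b - c - c * b / real n)"
          using elim by (simp add: N_def field_simps power2_eq_square)
        moreover have "2 * lam + b = 4 * lam\<^sup>2" by (simp add: b_def power2_eq_square algebra_simps)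
        ultimately have "(N n - c) * (1 + b / real n) = (real n)\<^sup>2 + 4 * lam\<^sup>2 * real n + (2 * lam * b - c - c * b / real n)"
          by simp
        moreover have "(N n - c) * V0 n = p / G * ((N n - c) * (1 + b / real n))"
          by (simp add: V0_def p_def)
        ultimately have "(N n - c) * V0 n =
            p / G * ((real n)\<^sup>2 + 4 * lam\<^sup>2 * real n + (2 * lam * b - c - c * b / real n))"
          by simp
        also have "\<dots> = p / G * ((real n)\<^sup>2 + 4 * lam\<^sup>2 * real n) +
            p / G * (2 * lam * b - c - c * b / real n)"
          by (rule distrib_left)
        finally show ?thesis by (simp add: ring_distribs add_divide_distrib mult_ac)
      qed
      have "4 * lam * l2_norm_sq (gegenbauer' lam n) =
          (N n - c) * V n + ((4 * lam - 2) * N n + c) * l2_norm_sq (gegenbauer lam n)"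
        using l2_norm_sq_gegenbauer'[of lam n] by (simp only: N_def V_def c_def)
      then show ?case
        unfolding p_def[symmetric] p G_def[symmetric] right_diff_distrib[of "N n - c"] key by simp
    qed
  qed
qed

lemma l2_norm_sq_gegenbauer'_Suc:
  "l2_norm_sq (gegenbauer' lam (Suc n)) = 4 * lam\<^sup>2 * l2_norm_sq (gegenbauer (lam + 1) n)"
proof -
  have "gegenbauer' lam (Suc n) = (\<lambda>x. (2 * lam) * gegenbauer (lam + 1) n x)"
    by (simp add: fun_eq_iff gegenbauer'_Suc)
  then show ?thesis
    using l2_norm_sq_scale[of "2 * lam" "gegenbauer (lam + 1) n"] by (simp add: power_mult_distrib)
qed

lemma Gamma_double_plus1_square: "lam > 0 \<Longrightarrow> (Gamma (2 * lam + 1))\<^sup>2 = 4 * lam\<^sup>2 * (Gamma (2 * lam))\<^sup>2" for lam :: real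
  using Gamma_real_plus1[of "2 * lam"] by (simp add: power_mult_distrib)

text \<open>Applies the expansion for y' at degree n + 1, where y' is a multiple of the polynomial
  of index \<open>lam + 1\<close> and degree n. Hence the powers of n + 1 in the main term.\<close>

lemma l2_norm_sq_gegenbauer_Suc_bigo:
  assumes lam: "lam > 0"
    and S: "(\<lambda>n. l2_norm_sq (gegenbauer lam n)) \<in> O(\<lambda>n. real n powr e)"
  shows "(\<lambda>n. l2_norm_sq (gegenbauer (lam + 1) n) -
           ((real n + 1) powr (4 * lam) + 4 * lam\<^sup>2 * (real n + 1) powr (4 * lam - 1)) / (4 * lam * (Gamma (2 * lam + 1))\<^sup>2))
         \<in> O(\<lambda>n. real n powr max (4 * lam - 2) (e + 2))"
proof -
  let ?M = "\<lambda>n. (real n + 1) powr (4 * lam) + 4 * lam\<^sup>2 * (real n + 1) powr (4 * lam - 1)"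
  have G: "Gamma (2 * lam) \<noteq> 0" using Gamma_real_pos[of "2 * lam"] lam by linarith
  have "(\<lambda>n. 4 * lam * l2_norm_sq (gegenbauer' lam (Suc n)) -
           (real (Suc n) powr (4 * lam) + 4 * lam\<^sup>2 * real (Suc n) powr (4 * lam - 1)) / (Gamma (2 * lam))\<^sup>2)
         \<in> O(\<lambda>n. real (Suc n) powr max (4 * lam - 2) (e + 2))"
    by (rule landau_o.big.compose[OF l2_norm_sq_gegenbauer'_bigo[OF assms] filterlim_Suc])
  also have "(\<lambda>n. real (Suc n) powr max (4 * lam - 2) (e + 2)) \<in> O(\<lambda>n. real n powr max (4 * lam - 2) (e + 2))"
    by real_asymp
  \<comment> \<open>16 lam^3 is the factor 4 lam of the identity times the 4 lam^2 from squaring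
    y'.\<close>
  finally have "(\<lambda>n. 1 / (16 * lam ^ 3) * (4 * lam * l2_norm_sq (gegenbauer' lam (Suc n)) -
           ?M n / (Gamma (2 * lam))\<^sup>2)) \<in> O(\<lambda>n. real n powr max (4 * lam - 2) (e + 2))"
    by (simp add: add.commute bigo_divide_const)
  moreover have "1 / (16 * lam ^ 3) * (4 * lam * l2_norm_sq (gegenbauer' lam (Suc n)) - ?M n / (Gamma (2 * lam))\<^sup>2)
      = l2_norm_sq (gegenbauer (lam + 1) n) - ?M n / (4 * lam * (Gamma (2 * lam + 1))\<^sup>2)" for n
    using lam G unfolding l2_norm_sq_gegenbauer'_Suc Gamma_double_plus1_square[OF lam]
    by (simp add: field_simps power2_eq_square power3_eq_cube)
  ultimately show ?thesis by simp
qed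

section \<open>Upper bounds for the norm at every positive index\<close>

lemma l2_norm_sq_gegenbauer_bigo_crude:
  assumes "lam > 0"
  shows "(\<lambda>n. l2_norm_sq (gegenbauer lam n)) \<in> O(\<lambda>n. real n powr (4 * lam - 2))"
proof -
  have "l2_norm_sq (gegenbauer lam n) \<le> (gegenbauer lam n 1)\<^sup>2" for n
  proof -
    have "l2_norm_sq (gegenbauer lam n) \<le> integral {0..1} (\<lambda>x::real. (gegenbauer lam n 1)\<^sup>2)"
      unfolding l2_norm_sq_def using assms
      by (intro integral_le integrable_continuous_interval continuous_intros gegenbauer_le_at_1) auto
    then show ?thesis by simp
  qed
  then have "(\<lambda>n. l2_norm_sq (gegenbauer lam n)) \<in> O(\<lambda>n. (gegenbauer lam n 1)\<^sup>2)"
    by (intro bigoI[of _ 1]) (simp add: l2_norm_sq_nonneg)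
  then show ?thesis
    using gegenbauer_at_1_bigo_crude[OF assms] by (rule landau_o.big_trans)
qed

text \<open>Bootstraps from index mu - 1: the crude bound there produces an error of the same order
  as the main term, which gains two powers of n over the crude bound at index mu.\<close>

lemma l2_norm_sq_gegenbauer_bigo_gt_1:
  assumes "mu > 1"
  shows "(\<lambda>n. l2_norm_sq (gegenbauer mu n)) \<in> O(\<lambda>n. real n powr (4 * mu - 4))"
proof -
  define lam where "lam = mu - 1"
  have lam: "lam > 0" and mu: "mu = lam + 1" using assms by (simp_all add: lam_def)
  define K where "K = 1 / (4 * lam * (Gamma (2 * lam + 1))\<^sup>2)"
  have "(\<lambda>n. l2_norm_sq (gegenbauer (lam + 1) n) -
      ((real n + 1) powr (4 * lam) + 4 * lam\<^sup>2 * (real n + 1) powr (4 * lam - 1)) * K) \<in> O(\<lambda>n. real n powr (4 * lam))"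
    using l2_norm_sq_gegenbauer_Suc_bigo[OF lam l2_norm_sq_gegenbauer_bigo_crude[OF lam]] by (simp add: K_def)
  moreover have "(\<lambda>n. ((real n + 1) powr (4 * lam) + 4 * lam\<^sup>2 * (real n + 1) powr (4 * lam - 1)) * K)
      \<in> O(\<lambda>n. real n powr (4 * lam))"
  proof -
    have "(\<lambda>n. (real n + 1) powr (4 * lam)) \<in> O(\<lambda>n. real n powr (4 * lam))"
      "(\<lambda>n. (real n + 1) powr (4 * lam - 1)) \<in> O(\<lambda>n. real n powr (4 * lam))"
      by real_asymp+
    then have "(\<lambda>n. (real n + 1) powr (4 * lam) + 4 * lam\<^sup>2 * (real n + 1) powr (4 * lam - 1))
      \<in> O(\<lambda>n. real n powr (4 * lam))" by (intro sum_in_bigo) auto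
    then show ?thesis by (simp add: mult.commute[of _ K])
  qed
  ultimately have "(\<lambda>n. (l2_norm_sq (gegenbauer (lam + 1) n) -
      ((real n + 1) powr (4 * lam) + 4 * lam\<^sup>2 * (real n + 1) powr (4 * lam - 1)) * K) +
      ((real n + 1) powr (4 * lam) + 4 * lam\<^sup>2 * (real n + 1) powr (4 * lam - 1)) * K) \<in> O(\<lambda>n. real n powr (4 * lam))"
    by (rule sum_in_bigo)
  then show ?thesis by (simp add: mu)
qed

text \<open>The exponent is max(4 lam - 3, 2 lam - 2). Sonin's bound gives 2 lam - 2 below index 1,
  the linear bound gives 1 at index 1, and bootstrapping gives 4 lam - 4 above it.\<close>

lemma l2_norm_sq_gegenbauer_bigo_delta:
  assumes "lam > 0"
  shows "(\<lambda>n. l2_norm_sq (gegenbauer lam n)) \<in> O(\<lambda>n. real n powr (delta lam - 2))"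
proof -
  consider "lam < 1" | "lam = 1" | "lam > 1" by linarith
  then show ?thesis
  proof cases
    case 1
    define A where "A = Beta (1 - lam) (1/2) * (2 powr (1 - 2 * lam) / (Gamma lam)\<^sup>2)"
    have "(\<lambda>n. l2_norm_sq (gegenbauer lam n)) \<in> O(\<lambda>n. real n powr (2 * lam - 2))"
    proof (rule bigoI)
      show "eventually (\<lambda>n. norm (l2_norm_sq (gegenbauer lam n)) \<le> A * norm (real n powr (2 * lam - 2))) sequentially"
        using eventually_ge_at_top[of 1]
      proof eventually_elim
        case (elim n)
        have "1 / real n powr (2 - 2 * lam) = real n powr (2 * lam - 2)"
          using elim by (simp flip: powr_minus_divide)
        then show ?case
          using l2_norm_sq_gegenbauer_less[OF assms 1 elim] l2_norm_sq_nonneg[of "gegenbauer lam n"]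
          by (simp add: A_def)
      qed
    qed
    then show ?thesis by (rule bigo_powr_mono[rotated]) (simp add: delta_def)
  next
    case 2
    have "(\<lambda>n. l2_norm_sq (gegenbauer 1 n)) \<in> O(\<lambda>n. (real n + 1) * (Beta (1 - 1/2) (1/2) / 2))"
      by (intro bigoI[of _ 1] eventually_mono[OF eventually_ge_at_top[of 1]])
         (use l2_norm_sq_gegenbauer_1_le l2_norm_sq_nonneg in \<open>auto intro!: order_trans[OF _ abs_ge_self]\<close>)
    also have "(\<lambda>n. (real n + 1) * (Beta (1 - 1/2) (1/2) / 2)) \<in> O(\<lambda>n. real n powr 1)"
      by real_asymp
    finally show ?thesis using 2 by (simp add: delta_def)
  next
    case 3
    show ?thesis
      by (rule bigo_powr_mono[OF _ l2_norm_sq_gegenbauer_bigo_gt_1[OF 3]]) (simp add: delta_def)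
  qed
qed

text \<open>Replacing n + 1 by n and dropping the second-order term costs O(n^(4 lam - 1)), which
  \<open>delta\<close> absorbs. The range lam > 0 serves both (A2) and, at index
  \<open>lam - 1\<close>, the norm needed for (B2).\<close>

lemma l2_norm_sq_gegenbauer_Suc_leading:
  assumes lam: "lam > 0"
  shows "(\<lambda>n. l2_norm_sq (gegenbauer (lam + 1) n) - real n powr (4 * lam) / (4 * lam * (Gamma (2 * lam + 1))\<^sup>2))
         \<in> O(\<lambda>n. real n powr delta lam)"
proof -
  define K where "K = 1 / (4 * lam * (Gamma (2 * lam + 1))\<^sup>2)"
  have "max (4 * lam - 2) (delta lam - 2 + 2) = delta lam" by (simp add: delta_def)
  with l2_norm_sq_gegenbauer_Suc_bigo[OF lam l2_norm_sq_gegenbauer_bigo_delta[OF lam]]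
  have 1: "(\<lambda>n. l2_norm_sq (gegenbauer (lam + 1) n) -
      ((real n + 1) powr (4 * lam) + 4 * lam\<^sup>2 * (real n + 1) powr (4 * lam - 1)) * K)
      \<in> O(\<lambda>n. real n powr delta lam)" by (simp add: K_def)
  have "(\<lambda>n. (real n + 1) powr (4 * lam) - real n powr (4 * lam)) \<in> O(\<lambda>n. real n powr (4 * lam - 1))"
    "(\<lambda>n. (real n + 1) powr (4 * lam - 1)) \<in> O(\<lambda>n. real n powr (4 * lam - 1))"
    using lam by real_asymp+
  then have "(\<lambda>n. K * (((real n + 1) powr (4 * lam) - real n powr (4 * lam)) + 4 * lam\<^sup>2 * (real n + 1) powr (4 * lam - 1)))
      \<in> O(\<lambda>n. real n powr (4 * lam - 1))"
    by (auto intro!: sum_in_bigo)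
  then have 2: "(\<lambda>n. K * (((real n + 1) powr (4 * lam) - real n powr (4 * lam)) + 4 * lam\<^sup>2 * (real n + 1) powr (4 * lam - 1)))
      \<in> O(\<lambda>n. real n powr delta lam)"
    by (rule bigo_powr_mono[rotated]) (simp add: delta_def)
  from sum_in_bigo(1)[OF 1 2]
  have "(\<lambda>n. l2_norm_sq (gegenbauer (lam + 1) n) - real n powr (4 * lam) * K) \<in> O(\<lambda>n. real n powr delta lam)"
    by (simp add: algebra_simps)
  then show ?thesis by (simp add: K_def)
qed

section \<open>Weighted norms and the second-order expansion\<close>

lemma l2_norm_sq_weighted_gegenbauer:
  assumes "n \<ge> 1"
  shows "4 * lam\<^sup>2 * l2_norm_sq (\<lambda>x. sqrt (1 - x\<^sup>2) * gegenbauer (lam + 1) (n - 1) x) =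
     (real n * (real n + 2 * lam) + (2 * lam - 1) / 2) * l2_norm_sq (gegenbauer lam n)
     - (2 * lam - 1) / 2 * (gegenbauer lam n 1)\<^sup>2"
proof -
  have "gegenbauer' lam n x = 2 * lam * gegenbauer (lam + 1) (n - 1) x" for x
    using gegenbauer'_Suc[of lam "n - 1" x] assms by simp
  then have "integral {0..1} (\<lambda>x. (1 - x\<^sup>2) * (gegenbauer' lam n x)\<^sup>2) =
      integral {0..1} (\<lambda>x. 4 * lam\<^sup>2 * ((1 - x\<^sup>2) * (gegenbauer (lam + 1) (n - 1) x)\<^sup>2))"
    by (simp add: power_mult_distrib mult_ac)
  then show ?thesis
    unfolding l2_norm_sq_weighted integral_weighted_gegenbauer'[symmetric] by simp
qed

text \<open>In the weighted identity n^2 times the norm of y gives the main term by (A1). The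
  remaining terms are O(n^(2 lam - 1)) and O(n^(4 lam - 2)), both within n^(delta - 1).\<close>

lemma l2_norm_sq_weighted_gegenbauer_upper:
  assumes lam: "0 < lam" "lam < 1"
  shows "\<exists>K>0. \<exists>N>0. \<forall>n::nat. n \<ge> N \<longrightarrow>
           l2_norm_sq (\<lambda>x. sqrt (1 - x\<^sup>2) * gegenbauer (lam + 1) (n - 1) x)
             < Beta (1 - lam) (1/2) / (Gamma (lam + 1))\<^sup>2 * (real n powr (2 * lam) / 2 powr (1 + 2 * lam))
               + K * real n powr (delta lam - 1)"
proof -
  define A where "A = Beta (1 - lam) (1/2) * (2 powr (1 - 2 * lam) / (Gamma lam)\<^sup>2)"
  \<comment> \<open>The absolute value is taken because 2 lam - 1 can have either sign.\<close>
  define h where "h = \<bar>(2 * lam - 1) / 2\<bar>"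
  have A: "A \<ge> 0" using lam
    by (auto simp: A_def Beta_def intro!: mult_nonneg_nonneg divide_nonneg_nonneg Gamma_real_nonneg)
  have "h \<ge> 0" by (simp add: h_def)
  obtain C where C: "C > 0" and ev: "eventually (\<lambda>n. norm ((gegenbauer lam n 1)\<^sup>2) \<le> C * norm (real n powr (4 * lam - 2))) at_top"
    using landau_o.bigE[OF gegenbauer_at_1_bigo_crude[OF lam(1)]] by blast
  then obtain N where N: "\<And>n. n \<ge> N \<Longrightarrow> (gegenbauer lam n 1)\<^sup>2 \<le> C * real n powr (4 * lam - 2)"
    by (auto simp: eventually_at_top_linorder)
  \<comment> \<open>Collects the coefficients of the error terms; the additional 1 makes the final
    inequality strict.\<close>
  define K where "K = ((2 * lam + h) * A + h * C + 1) / (4 * lam\<^sup>2)"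
  have K: "K > 0" using lam A C \<open>h \<ge> 0\<close> by (auto simp: K_def intro!: divide_pos_pos add_nonneg_pos)
  show ?thesis
  proof (intro exI[of _ K] exI[of _ "max N 1"] conjI allI impI K)
    fix n assume n: "max N 1 \<le> n"
    let ?T = "l2_norm_sq (\<lambda>x. sqrt (1 - x\<^sup>2) * gegenbauer (lam + 1) (n - 1) x)"
    define S where "S = l2_norm_sq (gegenbauer lam n)"
    define V where "V = (gegenbauer lam n 1)\<^sup>2"
    define D where "D = real n powr (delta lam - 1)"
    have n1: "real n \<ge> 1" using n by simp
    have D: "D > 0" using n1 by (simp add: D_def)
    have S: "S \<le> A * real n powr (2 * lam - 2)"
    proof -
      have "1 / real n powr (2 - 2 * lam) = real n powr (2 * lam - 2)"
        using n by (simp flip: powr_minus_divide)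
      then show ?thesis using l2_norm_sq_gegenbauer_less[OF lam, of n] n by (simp add: S_def A_def)
    qed
    have "(2 * lam - 1) / 2 * S \<le> h * S" "- ((2 * lam - 1) / 2 * V) \<le> h * V"
      unfolding h_def by (intro mult_right_mono abs_ge_self, simp add: S_def l2_norm_sq_nonneg)
        (simp only: mult_minus_left[symmetric], intro mult_right_mono abs_ge_minus_self, simp add: V_def)
    moreover have "4 * lam\<^sup>2 * ?T = real n * (real n + 2 * lam) * S + (2 * lam - 1) / 2 * S - (2 * lam - 1) / 2 * V"
      using l2_norm_sq_weighted_gegenbauer[of n lam] n unfolding S_def V_def by (simp only: distrib_right max.bounded_iff)
    ultimately have "4 * lam\<^sup>2 * ?T \<le> real n * (real n + 2 * lam) * S + h * S + h * V" by linarith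
    also have "\<dots> = ((real n)\<^sup>2 + (2 * lam * real n + h)) * S + h * V"
      by (simp add: algebra_simps power2_eq_square)
    also have "\<dots> \<le> ((real n)\<^sup>2 + (2 * lam + h) * real n) * (A * real n powr (2 * lam - 2)) + h * (C * real n powr (4 * lam - 2))"
    proof (intro add_mono mult_mono)
      have "h * 1 \<le> h * real n" using n1 \<open>h \<ge> 0\<close> by (intro mult_left_mono) auto
      then show "2 * lam * real n + h \<le> (2 * lam + h) * real n" by (simp add: algebra_simps)
      show "V \<le> C * real n powr (4 * lam - 2)" using N[of n] n by (simp add: V_def)
    qed (use S lam \<open>h \<ge> 0\<close> in \<open>auto simp: S_def V_def l2_norm_sq_nonneg\<close>)
    also have "\<dots> = A * real n powr (2 * lam) + ((2 * lam + h) * A * real n powr (2 * lam - 1) + h * C * real n powr (4 * lam - 2))"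
      using n1 by (simp add: powr_diff power2_eq_square field_simps)
    also have "\<dots> \<le> A * real n powr (2 * lam) + ((2 * lam + h) * A * D + h * C * D)"
      using n1 lam A C \<open>h \<ge> 0\<close> unfolding D_def
      by (intro add_left_mono add_mono mult_left_mono powr_mono) (auto simp: delta_def)
    also have "\<dots> < A * real n powr (2 * lam) + ((2 * lam + h) * A * D + h * C * D + D)"
      using D by simp
    also have "\<dots> = 4 * lam\<^sup>2 * (A / (4 * lam\<^sup>2) * real n powr (2 * lam) + K * D)"
      using lam by (simp add: K_def field_simps)
    finally have "?T < A / (4 * lam\<^sup>2) * real n powr (2 * lam) + K * D"
      using lam by simp
    also have "A / (4 * lam\<^sup>2) * real n powr (2 * lam) =
        Beta (1 - lam) (1/2) / (Gamma (lam + 1))\<^sup>2 * (real n powr (2 * lam) / 2 powr (1 + 2 * lam))"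
    proof -
      have "(Gamma (lam + 1))\<^sup>2 = lam\<^sup>2 * (Gamma lam)\<^sup>2"
        using lam by (simp add: Gamma_real_plus1 power_mult_distrib)
      then show ?thesis by (simp add: A_def powr_diff powr_add)
    qed
    finally show "?T < Beta (1 - lam) (1/2) / (Gamma (lam + 1))\<^sup>2 * (real n powr (2 * lam) / 2 powr (1 + 2 * lam))
        + K * real n powr (delta lam - 1)"
      by (simp add: D_def)
  qed simp
qed

text \<open>At degree n - 2 the main term consists of powers of n - 1. Expanding them subtracts 4
  lam from the second coefficient 4 lam^2, which explains the factor lam - 1.\<close>

lemma l2_norm_sq_gegenbauer_second_order:
  assumes lam: "lam > 1"
  shows "(\<lambda>n::nat. l2_norm_sq (gegenbauer (lam + 1) (n - 2))
             - (real n powr (4 * lam) / (4 * lam * (Gamma (2 * lam + 1))\<^sup>2)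
                + (lam - 1) / (Gamma (2 * lam + 1))\<^sup>2 * real n powr (4 * lam - 1)))
          \<in> O(\<lambda>n. real n powr (4 * lam - 2))"
proof -
  define q where "q = 4 * lam"
  define K where "K = 4 * lam * (Gamma (2 * lam + 1))\<^sup>2"
  have lam0: "lam > 0" using lam by simp
  have "(\<lambda>n. l2_norm_sq (gegenbauer (lam + 1) n) -
      ((real n + 1) powr q + 4 * lam\<^sup>2 * (real n + 1) powr (q - 1)) / K)
      \<in> O(\<lambda>n. real n powr (q - 2))"
    using l2_norm_sq_gegenbauer_Suc_bigo[OF lam0 l2_norm_sq_gegenbauer_bigo_gt_1[OF lam]]
    by (simp add: K_def q_def)
  moreover have "filterlim (\<lambda>n::nat. n - 2) at_top at_top"
    by (rule filterlim_minus_const_nat_at_top)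
  ultimately have "(\<lambda>n. l2_norm_sq (gegenbauer (lam + 1) (n - 2)) -
      ((real (n - 2) + 1) powr q + 4 * lam\<^sup>2 * (real (n - 2) + 1) powr (q - 1)) / K)
      \<in> O(\<lambda>n. real (n - 2) powr (q - 2))"
    by (rule landau_o.big.compose)
  \<comment> \<open>The exponent is positive, so the truncated n - 2 may be replaced by n even for
    small n.\<close>
  also have "(\<lambda>n. real (n - 2) powr (q - 2)) \<in> O(\<lambda>n. real n powr (q - 2))"
    using lam by (intro bigoI[of _ 1]) (auto intro!: always_eventually powr_mono2 simp: q_def)
  finally have 1: "(\<lambda>n. l2_norm_sq (gegenbauer (lam + 1) (n - 2)) -
      ((real (n - 2) + 1) powr q + 4 * lam\<^sup>2 * (real (n - 2) + 1) powr (q - 1)) / K)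
      \<in> O(\<lambda>n. real n powr (q - 2))" .
  have d: "(\<lambda>n. (real n - 1) powr q - real n powr q + q * real n powr (q - 1)) \<in> O(\<lambda>n. real n powr (q - 2))"
    "(\<lambda>n. (real n - 1) powr (q - 1) - real n powr (q - 1)) \<in> O(\<lambda>n. real n powr (q - 2))"
  proof -
    have "q > 2" using lam by (simp add: q_def)
    then show "(\<lambda>n. (real n - 1) powr q - real n powr q + q * real n powr (q - 1)) \<in> O(\<lambda>n. real n powr (q - 2))"
      "(\<lambda>n. (real n - 1) powr (q - 1) - real n powr (q - 1)) \<in> O(\<lambda>n. real n powr (q - 2))"
      by real_asymp+
  qed
  have "(\<lambda>n. 4 * lam\<^sup>2 * ((real n - 1) powr (q - 1) - real n powr (q - 1))) \<in> O(\<lambda>n. real n powr (q - 2))"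
    using d(2) by simp
  from sum_in_bigo(1)[OF d(1) this]
  have 2: "(\<lambda>n. (((real n - 1) powr q - real n powr q + q * real n powr (q - 1)) +
      4 * lam\<^sup>2 * ((real n - 1) powr (q - 1) - real n powr (q - 1))) / K) \<in> O(\<lambda>n. real n powr (q - 2))"
    by (rule bigo_divide_const)
  have G: "Gamma (2 * lam + 1) \<noteq> 0" using Gamma_real_pos[of "2 * lam + 1"] lam by linarith
  have "eventually (\<lambda>n. l2_norm_sq (gegenbauer (lam + 1) (n - 2)) -
      ((real (n - 2) + 1) powr q + 4 * lam\<^sup>2 * (real (n - 2) + 1) powr (q - 1)) / K +
      (((real n - 1) powr q - real n powr q + q * real n powr (q - 1)) +
      4 * lam\<^sup>2 * ((real n - 1) powr (q - 1) - real n powr (q - 1))) / K =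
      l2_norm_sq (gegenbauer (lam + 1) (n - 2))
             - (real n powr (4 * lam) / (4 * lam * (Gamma (2 * lam + 1))\<^sup>2)
                + (lam - 1) / (Gamma (2 * lam + 1))\<^sup>2 * real n powr (4 * lam - 1))) sequentially"
    using eventually_ge_at_top[of 2]
  proof eventually_elim
    case (elim n)
    then have "real (n - 2) + 1 = real n - 1" by (simp add: of_nat_diff)
    moreover have "(lam - 1) / (Gamma (2 * lam + 1))\<^sup>2 = (4 * lam\<^sup>2 - q) / K"
      using lam G by (simp add: K_def q_def field_simps power2_eq_square)
    ultimately show ?case
      unfolding K_def[symmetric] unfolding q_def[symmetric]
      by (simp add: ring_distribs add_divide_distrib diff_divide_distrib)
  qed
  from landau_o.big.in_cong[OF this] sum_in_bigo(1)[OF 1 2] show ?thesis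
    by (simp add: q_def)
qed

text \<open>Both terms of the weighted identity have order n^(4 lam - 2): the norm of y behaves like
  k n^(4 lam - 4) by the leading expansion from index lam - 1, and y(1)^2 like n^(4 lam - 2) / G.
  The limit constant is their difference.\<close>

lemma l2_norm_sq_weighted_gegenbauer_leading:
  assumes lam: "lam > 1"
  shows "(\<lambda>n::nat. l2_norm_sq (\<lambda>x. sqrt (1 - x\<^sup>2) * gegenbauer (lam + 1) (n - 1) x)
             - (2 * lam - 1) / (4 * (lam - 1) * (Gamma (2 * lam + 1))\<^sup>2) * real n powr (4 * lam - 2))
          \<in> O(\<lambda>n. real n powr (delta (lam - 1) + 2))"
proof -
  define e where "e = delta (lam - 1) + 2"
  define h where "h = (2 * lam - 1) / 2"
  define G where "G = (Gamma (2 * lam))\<^sup>2"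
  \<comment> \<open>The leading coefficient for index lam - 1, with Gamma(2 lam - 1) rewritten
    through Gamma(2 lam).\<close>
  define k where "k = (2 * lam - 1)\<^sup>2 / (4 * (lam - 1) * G)"
  define S where "S = (\<lambda>n. l2_norm_sq (gegenbauer lam n))"
  define V where "V = (\<lambda>n. (gegenbauer lam n 1)\<^sup>2)"
  have lam0: "lam > 0" "lam - 1 > 0" using lam by simp_all
  have e: "4 * lam - 3 \<le> e" by (simp add: e_def delta_def)
  have "Gamma (2 * lam) > 0" using lam by (intro Gamma_real_pos) simp
  then have G: "G > 0" by (simp add: G_def)
  have "Gamma (2 * lam) = (2 * lam - 1) * Gamma (2 * (lam - 1) + 1)"
    using Gamma_real_plus1[of "2 * lam - 1"] lam by (simp add: algebra_simps)
  then have k: "k = 1 / (4 * (lam - 1) * (Gamma (2 * (lam - 1) + 1))\<^sup>2)"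
    using lam by (simp add: k_def G_def power_mult_distrib)
  have S: "(\<lambda>n. S n - k * real n powr (4 * lam - 4)) \<in> O(\<lambda>n. real n powr delta (lam - 1))"
    using l2_norm_sq_gegenbauer_Suc_leading[OF lam0(2)] unfolding S_def k by simp
  have "(\<lambda>n. real n * (real n + 2 * lam) + h) \<in> O(\<lambda>n. real n powr 2)"
    by real_asymp
  then have 1: "(\<lambda>n. (real n * (real n + 2 * lam) + h) * (S n - k * real n powr (4 * lam - 4))) \<in> O(\<lambda>n. real n powr e)"
    by (rule bigo_square_mult_powr[OF _ S]) (simp add: e_def)
  have "(\<lambda>n. 2 * lam * real n + h) \<in> O(\<lambda>n. real n powr 1)" by real_asymp
  then have "(\<lambda>n. (2 * lam * real n + h) * (k * real n powr (4 * lam - 4))) \<in> O(\<lambda>n. real n powr 1 * real n powr (4 * lam - 4))"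
    by (intro landau_o.big.mult) auto
  then have 2: "(\<lambda>n. (2 * lam * real n + h) * (k * real n powr (4 * lam - 4))) \<in> O(\<lambda>n. real n powr e)"
    by (intro bigo_powr_mono[OF e]) (simp only: powr_add[symmetric], simp)
  define b where "b = 2 * lam * (2 * lam - 1)"
  have "(\<lambda>n. V n - real n powr (4 * lam - 2) * (1 + b / real n) / G) \<in> O(\<lambda>n. real n powr (4 * lam - 4))"
    using gegenbauer_at_1_bigo[OF lam0(1)] by (simp add: V_def G_def b_def)
  then have "(\<lambda>n. V n - real n powr (4 * lam - 2) * (1 + b / real n) / G) \<in> O(\<lambda>n. real n powr e)"
    by (rule bigo_powr_mono[rotated]) (use e in simp)
  moreover have "(\<lambda>n. real n powr (4 * lam - 2) * (b / real n) / G) \<in> O(\<lambda>n. real n powr e)"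
  proof (rule bigo_powr_mono[OF e])
    have "(\<lambda>n. real n powr (4 * lam - 2) * (b / real n)) \<in> O(\<lambda>n. real n powr (4 * lam - 3))" by real_asymp
    then show "(\<lambda>n. real n powr (4 * lam - 2) * (b / real n) / G) \<in> O(\<lambda>n. real n powr (4 * lam - 3))"
      by (rule bigo_divide_const)
  qed
  ultimately have "(\<lambda>n. (V n - real n powr (4 * lam - 2) * (1 + b / real n) / G) +
      real n powr (4 * lam - 2) * (b / real n) / G) \<in> O(\<lambda>n. real n powr e)"
    by (rule sum_in_bigo)
  then have "(\<lambda>n. V n - real n powr (4 * lam - 2) / G) \<in> O(\<lambda>n. real n powr e)"
    by (simp add: distrib_left add_divide_distrib)
  then have 3: "(\<lambda>n. h * (V n - real n powr (4 * lam - 2) / G)) \<in> O(\<lambda>n. real n powr e)" by simp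
  have "(\<lambda>n. ((real n * (real n + 2 * lam) + h) * (S n - k * real n powr (4 * lam - 4)) +
      (2 * lam * real n + h) * (k * real n powr (4 * lam - 4)) -
      h * (V n - real n powr (4 * lam - 2) / G)) / (4 * lam\<^sup>2)) \<in> O(\<lambda>n. real n powr e)"
    using 1 2 3 by (intro bigo_divide_const sum_in_bigo)
  then show ?thesis unfolding e_def
  proof (rule landau_o.big.in_cong[THEN iffD1, rotated])
    show "eventually (\<lambda>n. ((real n * (real n + 2 * lam) + h) * (S n - k * real n powr (4 * lam - 4)) +
      (2 * lam * real n + h) * (k * real n powr (4 * lam - 4)) -
      h * (V n - real n powr (4 * lam - 2) / G)) / (4 * lam\<^sup>2) =
      l2_norm_sq (\<lambda>x. sqrt (1 - x\<^sup>2) * gegenbauer (lam + 1) (n - 1) x)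
             - (2 * lam - 1) / (4 * (lam - 1) * (Gamma (2 * lam + 1))\<^sup>2) * real n powr (4 * lam - 2)) sequentially"
      using eventually_ge_at_top[of 1]
    proof eventually_elim
      case (elim n)
      let ?T = "l2_norm_sq (\<lambda>x. sqrt (1 - x\<^sup>2) * gegenbauer (lam + 1) (n - 1) x)"
      define p where "p = real n powr (4 * lam - 4)"
      define P where "P = real n powr (4 * lam - 2)"
      have P: "P = (real n)\<^sup>2 * p"
        using elim by (simp add: p_def P_def powr_diff power2_eq_square power4_eq_xxxx)
      have T: "4 * lam\<^sup>2 * ?T = (real n * (real n + 2 * lam) + h) * S n - h * V n"
        using l2_norm_sq_weighted_gegenbauer[OF elim, of lam] by (simp add: S_def V_def h_def)
      \<comment> \<open>Here (2 lam - 1) / (4 (lam - 1)) - 1/2 = 1 / (4 (lam - 1)) is the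
        cancellation behind the coefficient.\<close>
      have c: "k - h / G = 4 * lam\<^sup>2 * ((2 * lam - 1) / (4 * (lam - 1) * (Gamma (2 * lam + 1))\<^sup>2))"
        using lam G unfolding Gamma_double_plus1_square[OF lam0(1)] G_def[symmetric]
        by (simp add: k_def h_def field_simps power2_eq_square)
      have "(real n * (real n + 2 * lam) + h) * (S n - k * p) + (2 * lam * real n + h) * (k * p) - h * (V n - P / G)
          = ((real n * (real n + 2 * lam) + h) * S n - h * V n) - (k - h / G) * P"
        unfolding P by (simp add: algebra_simps power2_eq_square)
      also have "\<dots> = 4 * lam\<^sup>2 * (?T - (2 * lam - 1) / (4 * (lam - 1) * (Gamma (2 * lam + 1))\<^sup>2) * P)"
        unfolding T[symmetric] c by (simp only: right_diff_distrib mult.assoc)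
      finally show ?case unfolding p_def[symmetric] P_def[symmetric] using lam by simp
    qed
  qed
qed

theorem corollary1p4:
  fixes lam :: real
  shows
    "(0 < lam \<and> lam < 1 \<longrightarrow>
        (\<forall>n::nat. n \<ge> 1 \<longrightarrow>
           l2_norm_sq (gegenbauer lam n)
             < Beta (1 - lam) (1/2) * (2 powr (1 - 2 * lam) / (Gamma lam)\<^sup>2)
                 * (1 / real n powr (2 - 2 * lam)))
      \<and> (\<lambda>n::nat. l2_norm_sq (gegenbauer (lam + 1) n)
             - real n powr (4 * lam) / (4 * lam * (Gamma (2 * lam + 1))\<^sup>2))
          \<in> O(\<lambda>n. real n powr delta lam)
      \<and> (\<exists>K>0. \<exists>N>0. \<forall>n::nat. n \<ge> N \<longrightarrow>
           l2_norm_sq (\<lambda>x. sqrt (1 - x\<^sup>2) * gegenbauer (lam + 1) (n - 1) x)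
             < Beta (1 - lam) (1/2) / (Gamma (lam + 1))\<^sup>2
                 * (real n powr (2 * lam) / 2 powr (1 + 2 * lam))
               + K * real n powr (delta lam - 1)))
   \<and> (lam > 1 \<longrightarrow>
        (\<lambda>n::nat. l2_norm_sq (gegenbauer (lam + 1) (n - 2))
             - (real n powr (4 * lam) / (4 * lam * (Gamma (2 * lam + 1))\<^sup>2)
                + (lam - 1) / (Gamma (2 * lam + 1))\<^sup>2 * real n powr (4 * lam - 1)))
          \<in> O(\<lambda>n. real n powr (4 * lam - 2))
      \<and> (\<lambda>n::nat. l2_norm_sq (\<lambda>x. sqrt (1 - x\<^sup>2) * gegenbauer (lam + 1) (n - 1) x)
             - (2 * lam - 1) / (4 * (lam - 1) * (Gamma (2 * lam + 1))\<^sup>2)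
                 * real n powr (4 * lam - 2))
          \<in> O(\<lambda>n. real n powr (delta (lam - 1) + 2)))"
  using l2_norm_sq_gegenbauer_less l2_norm_sq_gegenbauer_Suc_leading l2_norm_sq_weighted_gegenbauer_upper
    l2_norm_sq_gegenbauer_second_order l2_norm_sq_weighted_gegenbauer_leading
  by (intro conjI impI allI) blast+

end
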